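(* Consider the quantum principal $\mathcal U(1)$-bundle $\zeta=(\mathbb T^{n+1}_\Xi,\mathbb T^n_\Xi,\Delta_P)$ over the quantum $n$-torus ($n\ge2$) described in the context, and the associated right quantum vector bundle $E=\mathrm{Mor}(\mathrm{ad},\Delta_P)$. Let $\widehat\nabla:E\to E\otimes_{\mathbb T^n_\Xi}\Omega^1(\mathbb T^n_\Xi)$ be a quantum linear connection compatible with the metric and different from $\widehat\nabla^\omega$ (the gauge quantum linear connection of any quantum principal connection $\omega$, which is the Grassmann connection), and let $0\ne\mu=\mu^*\in\Omega^1(\mathbb T^n_\Xi)$ be determined by $\widehat\nabla=\widehat\nabla^\omega+\widehat\Lambda$, $\widehat\Lambda(T^{\mathrm{triv}})=T^{\mathrm{triv}}\otimes_{\mathbb T^n_\Xi}\mu$. Then $\widehat\nabla$ is a Yang–Mills quantum linear connection if and only if $$d(\star_q(d\mu+\mu\,\mu))+\mu\,\star_q(d\mu+\mu\,\mu)+(-1)^{n-1}\star_q(d\mu+\mu\,\mu)\,\mu=0 .$$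
   Context: **Quantum tori.** Fix $n\ge2$ and a real antisymmetric $(n+1)\times(n+1)$ matrix $\Xi$. For $m\in\{n,n+1\}$, $\mathbb T^m_\Xi$ is the $*$-algebra of formal sums $\sum a_{k_1\cdots k_m}u_1^{k_1}\cdots u_m^{k_m}$ with rapidly decaying coefficients, with $u_k^*=u_k^{-1}$, $u_ku_j=e^{2\pi i\Xi_{kj}}u_ju_k$ ($k,j\le m$); $\mathbb T^n_\Xi\subset\mathbb T^{n+1}_\Xi$. $\delta_j$ is the derivation with $\delta_j(u_k)=2\pi i\,u_j$ if $k=j$ and $0$ otherwise. $\Omega^\bullet(\mathbb T^m_\Xi)=\mathbb T^m_\Xi\otimes\bigwedge^\bullet\mathbb C^m$ with $(x_1\otimes v_1)(x_2\otimes v_2)=x_1x_2\otimes v_1\wedge v_2$, $(x\otimes v)^*=x^*\otimes v^*$ ($v^*$ complex conjugation in the canonical basis $\bar e_j$), $d\mathbb U_j:=\mathbf 1\otimes\bar e_j$, $dx=i\sum_j\delta_j(x)\,d\mathbb U_j$, $d(x\,d\mathbb U_{j_1}\cdots d\mathbb U_{j_k})=dx\,d\mathbb U_{j_1}\cdots d\mathbb U_{j_k}$; so $d(a^* )=-(da)^*$. Hodge operator $\star_q:\Omega^k(\mathbb T^n_\Xi)\to\Omega^{n-k}(\mathbb T^n_\Xi)$, $x\otimes v\mapsto x\otimes\star v$, with $\star$ the Hodge operator of $\bigwedge^\bullet\mathbb C^n$. **Bundle.** $G=\mathbb C[z,z^{-1}]$, $z^*=z^{-1}$, $\Delta(z^k)=z^k\otimes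 z^k$, $S(z^k)=z^{k*}$. Classical calculus of $U(1)$: $\vartheta:=\pi(z)=z^*dz$, $\mathfrak u(1)^\#_{\mathbb C}=\mathbb C\vartheta$ (with $\vartheta$ of norm $1$), $\vartheta^*=\vartheta$, $\mathrm{ad}(\vartheta)=\vartheta\otimes\mathbf 1$. $P=\mathbb T^{n+1}_\Xi$, $\Delta_P:P\to P\otimes G$ the $*$-algebra morphism with $\Delta_P(u_i)=u_i\otimes\mathbf 1$ ($i\le n$), $\Delta_P(u_{n+1})=u_{n+1}\otimes z$; base algebra $B=\mathbb T^n_\Xi$, base forms $\Omega^\bullet(\mathbb T^n_\Xi)$. **Associated bundle.** $E=\mathrm{Mor}(\mathrm{ad},\Delta_P)$ consists of the linear maps $T:\mathbb C\vartheta\to P$ with $T(\vartheta)\in\mathbb T^n_\Xi$; as a right $\mathbb T^n_\Xi$-module it is free with basis $T^{\mathrm{triv}}$, $T^{\mathrm{triv}}(\vartheta)=\mathbf 1$. Metric: $\langle T_1,T_2\rangle_{\mathrm R}=T_1(\vartheta)^*T_2(\vartheta)$, extended by $\langle T_1\otimes\mu_1,T_2\otimes\mu_2\rangle_{\mathrm R}=\mu_1^*\langle T_1,T_2\rangle_{\mathrm R}\mu_2$. A quantum linear connection (qlc) is a linear map $\widehat\nabla:E\to E\otimes_B\Omega^1(B)$ with $\widehat\nabla(Tb)=\widehat\nabla(T)b+T\otimes db$; it is compatible with the metric if $\langle T_1,\widehat\nabla T_2\rangle_{\mathrm R}-\langle\widehat\nabla T_1,T_2\rangle_{\mathrm R}=d\langle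 T_1,T_2\rangle_{\mathrm R}$. The gauge qlc of every quantum principal connection is $\widehat\nabla^\omega(T^{\mathrm{triv}}b)=T^{\mathrm{triv}}\otimes db$. **Yang–Mills qlc.** Put $d^{\widehat\nabla}(T\otimes\nu)=\widehat\nabla(T)\nu+T\otimes d\nu$ and $R^{\widehat\nabla}=d^{\widehat\nabla}\circ\widehat\nabla$. For a right $B$-linear map $\widehat\Lambda:E\to E\otimes_B\Omega^k(B)$ let $\widehat\Lambda^{\mathrm{ext}}(T\otimes\nu)=\widehat\Lambda(T)\nu$ and $[\widehat\nabla,\widehat\Lambda]=d^{\widehat\nabla}\circ\widehat\Lambda-(-1)^k\widehat\Lambda^{\mathrm{ext}}\circ\widehat\nabla$. A metric-compatible qlc $\widehat\nabla$ is a Yang–Mills qlc if it satisfies the non-commutative analytical Yang–Mills equation $[\widehat\nabla,(\mathrm{id}_E\otimes_B\star_q)\circ R^{\widehat\nabla}]=0$. *)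

theory Defs
  imports
    "HOL-Analysis.Infinite_Sum"
    "HOL-Algebra.Free_Abelian_Groups"
    "HOL-Library.Function_Algebras"
begin

section \<open>Quantum tori\<close>

text \<open>
  Generators are indexed from \<open>0\<close>, so \<open>u\<^sub>j\<close> of the \<open>m\<close>-torus, \<open>1 \<le> j \<le> m\<close>, has index
  \<open>j - 1\<close> here, and the fibre generator \<open>u\<^sub>n\<^sub>+\<^sub>1\<close> has index \<open>n\<close>.  A formal sum
  \<open>\<Sum>\<^sub>k a\<^sub>k u\<^sup>k\<close>, where \<open>u\<^sup>k\<close> is the ordered monomial \<open>u\<^sub>0\<^bsup>k 0\<^esup> u\<^sub>1\<^bsup>k 1\<^esup> \<dots>\<close>, is its family of
  coefficients.  The exponents of the \<open>m\<close>-torus are those vanishing at all positions \<open>\<ge> m\<close>; with this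
  encoding the \<open>n\<close>-torus is literally a subset of the \<open>(n+1)\<close>-torus, with the same operations.
  Addition, zero and negation are the pointwise operations on function types.
\<close>

type_synonym exponent = "nat \<Rightarrow> int"
type_synonym qelt = "exponent \<Rightarrow> complex"

definition exponents :: "nat \<Rightarrow> exponent set" where
  "exponents m = {k. \<forall>i\<ge>m. k i = 0}"

definition qtorus :: "nat \<Rightarrow> qelt set" where
  "qtorus m = {a. (\<forall>k. k \<notin> exponents m \<longrightarrow> a k = 0) \<and>
     (\<forall>N::nat. \<exists>C::real. \<forall>k\<in>exponents m. (1 + (\<Sum>i<m. \<bar>real_of_int (k i)\<bar>)) ^ N * cmod (a k) \<le> C)}"

definition antisymmetric :: "nat \<Rightarrow> (nat \<Rightarrow> nat \<Rightarrow> real) \<Rightarrow> bool" where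
  "antisymmetric m \<Xi> \<longleftrightarrow> (\<forall>i<m. \<forall>j<m. \<Xi> i j = - \<Xi> j i)"

definition qmono :: "exponent \<Rightarrow> qelt" where
  "qmono k = (\<lambda>r. if r = k then 1 else 0)"

definition qone :: qelt where
  "qone = qmono 0"

definition qgen :: "nat \<Rightarrow> qelt" where
  "qgen j = qmono (\<lambda>i. if i = j then 1 else 0)"

definition qscale :: "complex \<Rightarrow> qelt \<Rightarrow> qelt" where
  "qscale c a = (\<lambda>k. c * a k)"

text \<open>
  Sorting \<open>u\<^sup>k u\<^sup>l\<close> with the commutation relations moves each \<open>u\<^sub>j\<^bsup>l j\<^esup>\<close> to the left past
  \<open>u\<^sub>i\<^bsup>k i\<^esup>\<close> for \<open>j < i\<close>, so that \<open>u\<^sup>k u\<^sup>l = qphase \<Xi> k l u\<^bsup>k + l\<^esup>\<close>; likewise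
  \<open>(u\<^sup>k)\<^sup>* = qphase \<Xi> k k u\<^bsup>-k\<^esup>\<close>.
\<close>

definition qphase :: "(nat \<Rightarrow> nat \<Rightarrow> real) \<Rightarrow> exponent \<Rightarrow> exponent \<Rightarrow> complex" where
  "qphase \<Xi> k l =
     cis (2 * pi * (\<Sum>i | k i \<noteq> 0. \<Sum>j<i. \<Xi> i j * real_of_int (k i) * real_of_int (l j)))"

definition qmult :: "(nat \<Rightarrow> nat \<Rightarrow> real) \<Rightarrow> qelt \<Rightarrow> qelt \<Rightarrow> qelt" where
  "qmult \<Xi> a b = (\<lambda>r. \<Sum>\<^sub>\<infinity>k. a k * b (r - k) * qphase \<Xi> k (r - k))"

definition qstar :: "(nat \<Rightarrow> nat \<Rightarrow> real) \<Rightarrow> qelt \<Rightarrow> qelt" where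
  "qstar \<Xi> a = (\<lambda>k. cnj (a (- k)) * qphase \<Xi> k k)"

definition qderiv :: "nat \<Rightarrow> qelt \<Rightarrow> qelt" where
  "qderiv j a = (\<lambda>k. 2 * pi * \<i> * of_int (k j) * a k)"

lemma qmult_qmono_left:
  "qmult \<Xi> (qmono k) b = (\<lambda>r. b (r - k) * qphase \<Xi> k (r - k))"
proof
  fix r
  have "qmult \<Xi> (qmono k) b r = (\<Sum>\<^sub>\<infinity>s\<in>{k}. qmono k s * b (r - s) * qphase \<Xi> s (r - s))"
    unfolding qmult_def by (rule infsum_cong_neutral) (auto simp: qmono_def)
  then show "qmult \<Xi> (qmono k) b r = b (r - k) * qphase \<Xi> k (r - k)"
    by (simp add: qmono_def)
qed

lemma qmult_qone_left [simp]: "qmult \<Xi> qone b = b"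
  by (simp add: qone_def qmult_qmono_left qphase_def)

lemma qmult_qmono: "qmult \<Xi> (qmono k) (qmono l) = qscale (qphase \<Xi> k l) (qmono (k + l))"
  unfolding qmult_qmono_left by (rule ext) (auto simp: qmono_def qscale_def algebra_simps)

lemma qphase_unit:
  "qphase \<Xi> (\<lambda>r. if r = i then 1 else 0) (\<lambda>r. if r = j then 1 else 0) =
     (if j < i then cis (2 * pi * \<Xi> i j) else 1)"
proof -
  have supp: "{r. (if r = i then 1 else 0::int) \<noteq> 0} = {i}" by auto
  have "(\<Sum>s<i. \<Xi> i s * real_of_int (if i = i then 1 else 0) * real_of_int (if s = j then 1 else 0)) =
      (\<Sum>s<i. if s = j then \<Xi> i j else 0)"
    by (rule sum.cong) auto
  also have "\<dots> = (if j < i then \<Xi> i j else 0)"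
    by simp
  finally show ?thesis
    unfolding qphase_def supp by (simp only: sum.insert_remove sum.empty finite.intros) simp
qed

lemma qgen_commute:
  assumes "antisymmetric m \<Xi>" "i < m" "j < m"
  shows "qmult \<Xi> (qgen i) (qgen j) = qscale (cis (2 * pi * \<Xi> i j)) (qmult \<Xi> (qgen j) (qgen i))"
proof -
  have anti: "\<Xi> j i = - \<Xi> i j"
    using assms unfolding antisymmetric_def by blast
  then have diag: "\<Xi> j j = 0" if "i = j"
    using that by (metis equal_neg_zero)
  have p: "(if j < i then cis (2 * pi * \<Xi> i j) else 1) =
      cis (2 * pi * \<Xi> i j) * (if i < j then cis (2 * pi * \<Xi> j i) else 1)"
    unfolding anti by (cases i j rule: linorder_cases) (simp_all add: diag cis_mult)
  have "qphase \<Xi> (\<lambda>r. if r = i then 1 else 0) (\<lambda>r. if r = j then 1 else 0) =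
      cis (2 * pi * \<Xi> i j) *
      qphase \<Xi> (\<lambda>r. if r = j then 1 else 0) (\<lambda>r. if r = i then 1 else 0)"
    unfolding qphase_unit by (rule p)
  then show ?thesis
    unfolding qgen_def qmult_qmono by (simp add: qscale_def mult.assoc add.commute)
qed

lemma qgen_unitary:
  assumes "antisymmetric m \<Xi>" "i < m"
  shows "qmult \<Xi> (qgen i) (qstar \<Xi> (qgen i)) = qone" "qmult \<Xi> (qstar \<Xi> (qgen i)) (qgen i) = qone"
proof -
  define e :: exponent where "e = (\<lambda>r. if r = i then 1 else 0)"
  have e: "{r. e r \<noteq> 0} = {i}" "{r. (- e) r \<noteq> 0} = {i}"
    by (auto simp: e_def)
  have s: "qstar \<Xi> (qgen i) = qmono (- e)"
  proof
    fix k
    have "- k = e \<longleftrightarrow> k = - e" by (metis minus_minus)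
    then show "qstar \<Xi> (qgen i) k = qmono (- e) k"
      using e by (auto simp: qstar_def qgen_def qmono_def qphase_def simp flip: e_def) 
        (auto simp: e_def)
  qed
  have g: "qgen i = qmono e" by (simp add: qgen_def e_def)
  have p: "qphase \<Xi> e (- e) = 1" "qphase \<Xi> (- e) e = 1"
    unfolding qphase_def e by (simp_all add: e_def)
  show "qmult \<Xi> (qgen i) (qstar \<Xi> (qgen i)) = qone" "qmult \<Xi> (qstar \<Xi> (qgen i)) (qgen i) = qone"
    unfolding s unfolding g by (simp_all add: qmult_qmono p qone_def qscale_def)
qed

lemma qderiv_qgen: "qderiv j (qgen k) = (if k = j then qscale (2 * pi * \<i>) (qgen j) else 0)"
  by (rule ext) (auto simp: qderiv_def qgen_def qmono_def qscale_def)

lemma qderiv_qmono_mult: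
  "qderiv j (qmult \<Xi> (qmono k) (qmono l)) =
     qmult \<Xi> (qderiv j (qmono k)) (qmono l) + qmult \<Xi> (qmono k) (qderiv j (qmono l))"
proof -
  have d: "qderiv j (qmono k) = qscale (2 * pi * \<i> * of_int (k j)) (qmono k)" for k
    by (rule ext) (auto simp: qderiv_def qmono_def qscale_def)
  have l: "qmult \<Xi> (qscale c (qmono k)) b = qscale c (qmult \<Xi> (qmono k) b)" for c b
    by (rule ext) (simp add: qmult_def qscale_def mult.assoc infsum_cmult_right')
  have r: "qmult \<Xi> (qmono k) (qscale c b) = qscale c (qmult \<Xi> (qmono k) b)" for c b
    by (rule ext) (simp add: qmult_qmono_left qscale_def)
  show ?thesis
    unfolding d l r qmult_qmono
    by (rule ext) (auto simp: qscale_def qderiv_def qmono_def algebra_simps)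
qed


section \<open>Differential forms\<close>

text \<open>
  A form \<open>\<Sum>\<^sub>I x\<^sub>I \<otimes> e\<^sub>I\<close> is the family of its coefficients, indexed by the sets
  \<open>I = {j\<^sub>1 < \<dots> < j\<^sub>k}\<close>, with \<open>e\<^sub>I = e\<^bsub>j\<^sub>1\<^esub> \<and> \<dots> \<and> e\<^bsub>j\<^sub>k\<^esub>\<close> the canonical basis of the exterior algebra.
  The sign \<open>wedge_sign I J\<close> is that of \<open>e\<^sub>I \<and> e\<^sub>J = \<plusminus> e\<^bsub>I \<union> J\<^esub>\<close> for disjoint \<open>I\<close>, \<open>J\<close>.
\<close>

type_synonym qform = "nat set \<Rightarrow> qelt"

definition forms :: "nat \<Rightarrow> qform set" where
  "forms m = {\<omega>. \<forall>I. \<omega> I \<in> qtorus m \<and> (\<not> I \<subseteq> {..<m} \<longrightarrow> \<omega> I = 0)}"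

definition forms_deg :: "nat \<Rightarrow> nat \<Rightarrow> qform set" where
  "forms_deg m k = {\<omega> \<in> forms m. \<forall>I. card I \<noteq> k \<longrightarrow> \<omega> I = 0}"

definition fscale :: "complex \<Rightarrow> qform \<Rightarrow> qform" where
  "fscale c \<omega> = (\<lambda>I. qscale c (\<omega> I))"

definition felem :: "qelt \<Rightarrow> nat set \<Rightarrow> qform" where
  "felem x J = (\<lambda>I. if I = J then x else 0)"

abbreviation form0 :: "qelt \<Rightarrow> qform" where
  "form0 x \<equiv> felem x {}"

definition wedge_sign :: "nat set \<Rightarrow> nat set \<Rightarrow> complex" where
  "wedge_sign I J = (- 1) ^ card {(i, j). i \<in> I \<and> j \<in> J \<and> j < i}"

definition fmult :: "(nat \<Rightarrow> nat \<Rightarrow> real) \<Rightarrow> qform \<Rightarrow> qform \<Rightarrow> qform" where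
  "fmult \<Xi> \<omega> \<eta> = (\<lambda>K. \<Sum>I\<in>Pow K. qscale (wedge_sign I (K - I)) (qmult \<Xi> (\<omega> I) (\<eta> (K - I))))"

definition fstar :: "(nat \<Rightarrow> nat \<Rightarrow> real) \<Rightarrow> qform \<Rightarrow> qform" where
  "fstar \<Xi> \<omega> = (\<lambda>I. qstar \<Xi> (\<omega> I))"

definition d0 :: "nat \<Rightarrow> qelt \<Rightarrow> qform" where
  "d0 m x = (\<Sum>j<m. felem (qscale \<i> (qderiv j x)) {j})"

definition ext_d :: "(nat \<Rightarrow> nat \<Rightarrow> real) \<Rightarrow> nat \<Rightarrow> qform \<Rightarrow> qform" where
  "ext_d \<Xi> m \<omega> = (\<Sum>I\<in>Pow {..<m}. fmult \<Xi> (d0 m (\<omega> I)) (felem qone I))"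

text \<open>
  The complex-linear Hodge operator of the exterior algebra of \<open>\<complex>\<^sup>m\<close>, normalised by
  \<open>e\<^sub>I \<and> \<star>e\<^sub>I = e\<^sub>0 \<and> \<dots> \<and> e\<^bsub>m-1\<^esub>\<close>, acting on the second tensor factor.
\<close>

definition hodge :: "nat \<Rightarrow> qform \<Rightarrow> qform" where
  "hodge m \<omega> =
     (\<Sum>I\<in>Pow {..<m}. felem (qscale (wedge_sign I ({..<m} - I)) (\<omega> I)) ({..<m} - I))"


section \<open>The bundle and its associated vector bundle\<close>

text \<open>
  An element \<open>\<Sum>\<^sub>l x\<^sub>l \<otimes> z\<^sup>l\<close> of \<open>X \<otimes> \<complex>[z, z\<^sup>-\<^sup>1]\<close> is the family \<open>l \<mapsto> x\<^sub>l\<close> of type \<open>int \<Rightarrow> X\<close>; since a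
  rapidly decaying series involves infinitely many powers of the last generator, \<open>P \<otimes> G\<close> has to be
  read as a completed tensor product.  The coaction \<open>\<Delta>\<^sub>P\<close>
  is \<open>u\<^sup>k \<mapsto> u\<^sup>k \<otimes> z\<^bsup>k n\<^esup>\<close>.  The space \<open>\<complex>\<vartheta>\<close> is modelled by \<^typ>\<open>complex\<close>, with \<open>\<vartheta> = 1\<close>.
\<close>

definition coaction :: "nat \<Rightarrow> qelt \<Rightarrow> (int \<Rightarrow> qelt)" where
  "coaction n a = (\<lambda>l k. if k n = l then a k else 0)"

definition theta :: complex where
  "theta = 1"

definition ad :: "complex \<Rightarrow> (int \<Rightarrow> complex)" where
  "ad v = (\<lambda>l. if l = 0 then v else 0)"

type_synonym mor = "complex \<Rightarrow> qelt"

text \<open>The intertwining condition reads \<open>\<Delta>\<^sub>P \<circ> T = (T \<otimes> id) \<circ> ad\<close>.\<close>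

definition Mor :: "nat \<Rightarrow> mor set" where
  "Mor n = {T. (\<forall>v w. T (v + w) = T v + T w) \<and> (\<forall>c v. T (c * v) = qscale c (T v)) \<and>
     (\<forall>v. T v \<in> qtorus (n + 1)) \<and> (\<forall>v. coaction n (T v) = (\<lambda>l. T (ad v l)))}"

definition mor_scale :: "complex \<Rightarrow> mor \<Rightarrow> mor" where
  "mor_scale c T = (\<lambda>v. qscale c (T v))"

definition mor_mult :: "(nat \<Rightarrow> nat \<Rightarrow> real) \<Rightarrow> mor \<Rightarrow> qelt \<Rightarrow> mor" where
  "mor_mult \<Xi> T b = (\<lambda>v. qmult \<Xi> (T v) b)"

definition Ttriv :: mor where
  "Ttriv = (\<lambda>v. qscale v qone)"

definition mor_inner :: "(nat \<Rightarrow> nat \<Rightarrow> real) \<Rightarrow> mor \<Rightarrow> mor \<Rightarrow> qelt" where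
  "mor_inner \<Xi> T1 T2 = qmult \<Xi> (qstar \<Xi> (T1 theta)) (T2 theta)"


section \<open>The tensor product over the base algebra\<close>

text \<open>
  \<open>E \<otimes>\<^sub>B \<Omega>\<^sup>\<bullet>(B)\<close> is the free abelian group on \<open>E \<times> \<Omega>\<^sup>\<bullet>(B)\<close> modulo biadditivity and
  \<open>Tb \<otimes> \<omega> = T \<otimes> b\<omega>\<close>; as \<open>B\<close> contains the scalars, complex bilinearity is included.  The group
  operation of a quotient group is written multiplicatively in the library.
  \<open>E \<otimes>\<^sub>B \<Omega>\<^sup>k(B)\<close> is the subgroup generated by the elementary tensors of degree \<open>k\<close> (a direct
  summand, since \<open>\<Omega>\<^sup>\<bullet>(B)\<close> is the direct sum of the bimodules \<open>\<Omega>\<^sup>k(B)\<close>).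
\<close>

type_synonym tens = "(mor \<times> qform \<Rightarrow>\<^sub>0 int) set"

context
  fixes \<Xi> :: "nat \<Rightarrow> nat \<Rightarrow> real" and n :: nat
begin

definition tensor_free :: "(mor \<times> qform \<Rightarrow>\<^sub>0 int) monoid" where
  "tensor_free = free_Abelian_group (Mor n \<times> forms n)"

definition tensor_rels :: "(mor \<times> qform \<Rightarrow>\<^sub>0 int) set" where
  "tensor_rels =
     {frag_of (S + T, \<omega>) - frag_of (S, \<omega>) - frag_of (T, \<omega>) | S T \<omega>.
        S \<in> Mor n \<and> T \<in> Mor n \<and> \<omega> \<in> forms n} \<union>
     {frag_of (T, \<omega> + \<eta>) - frag_of (T, \<omega>) - frag_of (T, \<eta>) | T \<omega> \<eta>.
        T \<in> Mor n \<and> \<omega> \<in> forms n \<and> \<eta> \<in> forms n} \<union>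
     {frag_of (mor_mult \<Xi> T b, \<omega>) - frag_of (T, fmult \<Xi> (form0 b) \<omega>) | T b \<omega>.
        T \<in> Mor n \<and> b \<in> qtorus n \<and> \<omega> \<in> forms n}"

definition tensor :: "tens monoid" where
  "tensor = tensor_free Mod (generate tensor_free tensor_rels)"

definition tns :: "mor \<Rightarrow> qform \<Rightarrow> tens" where
  "tns T \<omega> = generate tensor_free tensor_rels #>\<^bsub>tensor_free\<^esub> frag_of (T, \<omega>)"

definition tensor_deg :: "nat \<Rightarrow> tens set" where
  "tensor_deg k = generate tensor {tns T \<omega> | T \<omega>. T \<in> Mor n \<and> \<omega> \<in> forms_deg n k}"

text \<open>
  The additive map out of \<open>E \<otimes>\<^sub>B \<Omega>\<^sup>\<bullet>(B)\<close> with prescribed values \<open>T \<otimes> \<omega> \<mapsto> \<phi> T \<omega>\<close>, which exists and is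
  unique whenever \<open>\<phi>\<close> is biadditive and balanced over \<open>B\<close>.
\<close>

definition tensor_lift :: "'c monoid \<Rightarrow> (mor \<Rightarrow> qform \<Rightarrow> 'c) \<Rightarrow> tens \<Rightarrow> 'c" where
  "tensor_lift H \<phi> = (THE D. D \<in> hom tensor H \<and> D \<in> extensional (carrier tensor) \<and>
     (\<forall>T\<in>Mor n. \<forall>\<omega>\<in>forms n. D (tns T \<omega>) = \<phi> T \<omega>))"

definition form_group :: "qform monoid" where
  "form_group = \<lparr>carrier = forms n, mult = (+), one = 0\<rparr>"

definition tscale :: "complex \<Rightarrow> tens \<Rightarrow> tens" where
  "tscale c = tensor_lift tensor (\<lambda>T \<nu>. tns T (fscale c \<nu>))"

definition tmult :: "tens \<Rightarrow> qform \<Rightarrow> tens" where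
  "tmult X \<eta> = tensor_lift tensor (\<lambda>T \<nu>. tns T (fmult \<Xi> \<nu> \<eta>)) X"

definition thodge :: "tens \<Rightarrow> tens" where
  "thodge = tensor_lift tensor (\<lambda>T \<nu>. tns T (hodge n \<nu>))"

text \<open>\<open>\<langle>T\<^sub>1 \<otimes> \<mu>\<^sub>1, T\<^sub>2 \<otimes> \<mu>\<^sub>2\<rangle> = \<mu>\<^sub>1\<^sup>* \<langle>T\<^sub>1, T\<^sub>2\<rangle> \<mu>\<^sub>2\<close>\<close>

definition tinner :: "tens \<Rightarrow> tens \<Rightarrow> qform" where
  "tinner X Y = tensor_lift form_group (\<lambda>T2 \<mu>2. tensor_lift form_group (\<lambda>T1 \<mu>1.
     fmult \<Xi> (fmult \<Xi> (fstar \<Xi> \<mu>1) (form0 (mor_inner \<Xi> T1 T2))) \<mu>2) X) Y"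


section \<open>Quantum linear connections\<close>

definition qlc :: "(mor \<Rightarrow> tens) \<Rightarrow> bool" where
  "qlc D \<longleftrightarrow>
     (\<forall>T\<in>Mor n. D T \<in> tensor_deg 1) \<and>
     (\<forall>S\<in>Mor n. \<forall>T\<in>Mor n. D (S + T) = D S \<otimes>\<^bsub>tensor\<^esub> D T) \<and>
     (\<forall>c. \<forall>T\<in>Mor n. D (mor_scale c T) = tscale c (D T)) \<and>
     (\<forall>T\<in>Mor n. \<forall>b\<in>qtorus n. D (mor_mult \<Xi> T b) =
        tmult (D T) (form0 b) \<otimes>\<^bsub>tensor\<^esub> tns T (ext_d \<Xi> n (form0 b)))"

text \<open>Here \<open>T \<in> E\<close> is identified with \<open>T \<otimes> \<one>\<close>.\<close>

definition metric_compatible :: "(mor \<Rightarrow> tens) \<Rightarrow> bool" where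
  "metric_compatible D \<longleftrightarrow> (\<forall>T1\<in>Mor n. \<forall>T2\<in>Mor n.
     tinner (tns T1 (form0 qone)) (D T2) - tinner (D T1) (tns T2 (form0 qone)) =
     ext_d \<Xi> n (form0 (mor_inner \<Xi> T1 T2)))"

text \<open>
  The common gauge connection of all principal connections, \<open>T\<^sup>t\<^sup>r\<^sup>i\<^sup>v b \<mapsto> T\<^sup>t\<^sup>r\<^sup>i\<^sup>v \<otimes> db\<close>; the coordinate
  of \<open>T\<close> in the basis \<open>T\<^sup>t\<^sup>r\<^sup>i\<^sup>v\<close> is \<open>b = T \<vartheta>\<close>.
\<close>

definition gauge_qlc :: "mor \<Rightarrow> tens" where
  "gauge_qlc T = tns Ttriv (ext_d \<Xi> n (form0 (T theta)))"

lemma gauge_qlc_Ttriv_mult: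
  "gauge_qlc (mor_mult \<Xi> Ttriv b) = tns Ttriv (ext_d \<Xi> n (form0 b))"
proof -
  have "mor_mult \<Xi> Ttriv b theta = b"
    by (simp add: mor_mult_def Ttriv_def theta_def qscale_def)
  then show ?thesis
    by (simp add: gauge_qlc_def)
qed

definition right_linear :: "nat \<Rightarrow> (mor \<Rightarrow> tens) \<Rightarrow> bool" where
  "right_linear k L \<longleftrightarrow>
     (\<forall>T\<in>Mor n. L T \<in> tensor_deg k) \<and>
     (\<forall>S\<in>Mor n. \<forall>T\<in>Mor n. L (S + T) = L S \<otimes>\<^bsub>tensor\<^esub> L T) \<and>
     (\<forall>T\<in>Mor n. \<forall>b\<in>qtorus n. L (mor_mult \<Xi> T b) = tmult (L T) (form0 b))"

definition ext_cov_deriv :: "(mor \<Rightarrow> tens) \<Rightarrow> tens \<Rightarrow> tens" where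
  "ext_cov_deriv D =
     tensor_lift tensor (\<lambda>T \<nu>. tmult (D T) \<nu> \<otimes>\<^bsub>tensor\<^esub> tns T (ext_d \<Xi> n \<nu>))"

definition curvature :: "(mor \<Rightarrow> tens) \<Rightarrow> mor \<Rightarrow> tens" where
  "curvature D T = ext_cov_deriv D (D T)"

definition extend_linear :: "(mor \<Rightarrow> tens) \<Rightarrow> tens \<Rightarrow> tens" where
  "extend_linear L = tensor_lift tensor (\<lambda>T \<nu>. tmult (L T) \<nu>)"

text \<open>\<open>[D, L] = d\<^sup>D \<circ> L - (-1)\<^sup>k L\<^sup>e\<^sup>x\<^sup>t \<circ> D\<close> for \<open>L\<close> of degree \<open>k\<close>\<close>

definition qlc_commutator :: "nat \<Rightarrow> (mor \<Rightarrow> tens) \<Rightarrow> (mor \<Rightarrow> tens) \<Rightarrow> mor \<Rightarrow> tens" where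
  "qlc_commutator k D L T = ext_cov_deriv D (L T) \<otimes>\<^bsub>tensor\<^esub>
     inv\<^bsub>tensor\<^esub> (tscale ((- 1) ^ k) (extend_linear L (D T)))"

definition yang_mills_qlc :: "(mor \<Rightarrow> tens) \<Rightarrow> bool" where
  "yang_mills_qlc D \<longleftrightarrow> qlc D \<and> metric_compatible D \<and>
     (\<forall>T\<in>Mor n. qlc_commutator (n - 2) D (\<lambda>S. thodge (curvature D S)) T = \<one>\<^bsub>tensor\<^esub>)"

end

end

theory Submission
  imports Defs "HOL-Analysis.Summation_Tests"
begin

text \<open>
  The bundle \<open>E\<close> is free of rank one, so everything takes place in \<open>\<Omega>\<^sup>\<bullet>(\<bbbT>\<^sup>n)\<close>.  Every \<open>T \<in> E\<close> is \<open>T\<^sup>t\<^sup>r\<^sup>i\<^sup>v b\<close>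
  with \<open>b = T(\<vartheta>)\<close>, and \<open>\<omega> \<mapsto> T\<^sup>t\<^sup>r\<^sup>i\<^sup>v \<otimes> \<omega>\<close> is an isomorphism of groups from the forms onto
  \<open>E \<otimes>\<^sub>B \<Omega>\<^sup>\<bullet>(B)\<close>; it is onto because \<open>T \<otimes> \<omega> = T\<^sup>t\<^sup>r\<^sup>i\<^sup>v \<otimes> b\<omega>\<close>, and injective because \<open>T \<otimes> \<omega> \<mapsto> T(\<vartheta>)\<omega>\<close>
  respects the defining relations of the tensor product.  Under this isomorphism the connection becomes
  \<open>b \<mapsto> db + \<mu>b\<close>, its extension to forms becomes \<open>\<nu> \<mapsto> d\<nu> + \<mu>\<nu>\<close>, and the Leibniz rule together with
  \<open>d\<^sup>2 = 0\<close> turns the curvature into left multiplication by \<open>F = d\<mu> + \<mu>\<mu>\<close>: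
  the terms \<open>\<mu> db\<close> and \<open>- \<mu> db\<close> cancel.  The Hodge operator acts on coefficients
  only through scalars, so it commutes with multiplication by \<open>b\<close> and the operator \<open>\<star>R\<close> is left
  multiplication by \<open>\<star>F\<close>, a form of degree \<open>n - 2\<close>.  In the commutator of the connection with that operator the
  derivatives of \<open>b\<close> cancel once more, leaving left multiplication of \<open>b\<close> by
  \<open>d(\<star>F) + \<mu> \<star>F + (-1)\<^sup>n\<^sup>-\<^sup>1 \<star>F \<mu>\<close>.  This vanishes for all \<open>b\<close> exactly when it vanishes for \<open>b = 1\<close>.

  Two things have to be established before this computation makes sense.  The analytic part is that rapidly
  decaying coefficient families are closed under the twisted convolution, and that this product is
  associative and bilinear and makes the \<open>\<delta>\<^sub>j\<close> derivations; all of it rests on the absolute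
  convergence of the sums involved.  The algebraic part is that forms are an associative
  graded algebra on which \<open>d = \<Sum>\<^sub>j dU\<^sub>j \<partial>\<^sub>j\<close> is a differential (\<open>fmult_assoc\<close>, \<open>ext_d_fmult\<close>,
  \<open>ext_d_ext_d\<close>).  The passage to the trivialisation is \<open>tns_eq_triv\<close>, \<open>triv_inject\<close> and
  \<open>tensor_lift_tns\<close>, and the computation itself is \<open>ext_cov_deriv_triv\<close>, \<open>curvature_eq\<close> and
  \<open>qlc_commutator_eq\<close>.
\<close>

section \<open>Rapid decay and the algebra of the quantum torus\<close>

definition weight :: "nat \<Rightarrow> exponent \<Rightarrow> real" where
  "weight m k = 1 + (\<Sum>i<m. \<bar>real_of_int (k i)\<bar>)"

lemma weight_ge_1: "1 \<le> weight m k"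
  by (simp add: weight_def sum_nonneg)

lemma weight_add_le: "weight m (k + l) \<le> weight m k * weight m l"
proof -
  let ?s = "\<lambda>k::exponent. \<Sum>i<m. \<bar>real_of_int (k i)\<bar>"
  have "?s (k + l) \<le> ?s k + ?s l"
    by (auto simp flip: sum.distrib intro!: sum_mono)
  moreover have "0 \<le> ?s k * ?s l"
    by (simp add: sum_nonneg)
  ultimately show ?thesis
    unfolding weight_def distrib_left distrib_right by linarith
qed

lemma abs_component_le_weight:
  assumes "j < m"
  shows "\<bar>real_of_int (k j)\<bar> \<le> weight m k"
  using member_le_sum[of j "{..<m}" "\<lambda>i. \<bar>real_of_int (k i)\<bar>"] assms
  by (simp add: weight_def)

lemma summable_on_int_inverse_squares:
  "(\<lambda>j::int. 1 / (1 + \<bar>real_of_int j\<bar>)\<^sup>2) summable_on UNIV"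
proof -
  let ?f = "\<lambda>j::int. 1 / (1 + \<bar>real_of_int j\<bar>)\<^sup>2"
  have "summable (\<lambda>n::nat. 1 / (1 + real n)\<^sup>2)"
    using summable_Suc_iff[of "\<lambda>n. inverse (real n ^ 2)"] inverse_power_summable[of 2, where 'a=real]
    by (simp add: inverse_eq_divide)
  then have nat: "(\<lambda>n::nat. 1 / (1 + real n)\<^sup>2) summable_on UNIV"
    by (intro norm_summable_imp_summable_on) simp
  have "?f summable_on range int"
    by (subst summable_on_reindex) (use nat in \<open>auto simp: o_def\<close>)
  moreover have "?f summable_on range (\<lambda>n. - int n)"
    by (subst summable_on_reindex) (use nat in \<open>auto simp: o_def inj_on_def\<close>)
  ultimately have "?f summable_on (range int \<union> range (\<lambda>n. - int n))"
    by (rule summable_on_union)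
  moreover have "range int \<union> range (\<lambda>n. - int n) = UNIV"
    by (auto intro: int_cases2)
  ultimately show ?thesis
    by simp
qed

text \<open>Splitting off the last coordinate reduces the lattice sum to a product of sums over the integers.\<close>

lemma summable_on_exponents_prod:
  "(\<lambda>k. \<Prod>i<m. 1 / (1 + \<bar>real_of_int (k i)\<bar>)\<^sup>2) summable_on exponents m"
proof (induction m)
  case 0
  have "exponents 0 = {0}"
    by (auto simp: exponents_def)
  then show ?case
    by simp
next
  case (Suc m)
  let ?g = "\<lambda>m (k::exponent). \<Prod>i<m. 1 / (1 + \<bar>real_of_int (k i)\<bar>)\<^sup>2"
  let ?h = "\<lambda>j::int. 1 / (1 + \<bar>real_of_int j\<bar>)\<^sup>2"
  have "(\<lambda>p. ?g m (fst p) * ?h (snd p)) summable_on (exponents m \<times> UNIV)"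
  proof (rule summable_on_SigmaI)
    fix k :: exponent
    show "((\<lambda>j. ?g m (fst (k, j)) * ?h (snd (k, j))) has_sum ?g m k * infsum ?h UNIV) UNIV"
      unfolding fst_conv snd_conv
      by (rule has_sum_cmult_right[OF has_sum_infsum[OF summable_on_int_inverse_squares]])
  next
    show "(\<lambda>k. ?g m k * infsum ?h UNIV) summable_on exponents m"
      using Suc.IH by (rule summable_on_cmult_left)
  qed (auto intro!: divide_nonneg_nonneg prod_nonneg)
  also have "?this \<longleftrightarrow> ?g (Suc m) summable_on exponents (Suc m)"
  proof (rule summable_on_reindex_bij_witness)
    fix k :: exponent
    assume k: "k \<in> exponents (Suc m)"
    show "(\<lambda>p. (fst p)(m := snd p)) ((\<lambda>k. (k(m := 0), k m)) k) = k"
      by simp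
    have "(k(m := 0)) i = 0" if "m \<le> i" for i
      using k that by (cases "i = m") (auto simp: exponents_def)
    then show "(\<lambda>k. (k(m := 0), k m)) k \<in> exponents m \<times> UNIV"
      by (simp add: exponents_def)
  next
    fix p :: "exponent \<times> int"
    assume p: "p \<in> exponents m \<times> UNIV"
    then have "fst p m = 0"
      by (auto simp: exponents_def)
    then show "(\<lambda>k. (k(m := 0), k m)) ((\<lambda>p. (fst p)(m := snd p)) p) = p"
      by (metis fun_upd_same fun_upd_triv fun_upd_upd prod.collapse)
    show "(\<lambda>p. (fst p)(m := snd p)) p \<in> exponents (Suc m)"
      using p by (auto simp: exponents_def)
    show "?g (Suc m) ((\<lambda>p. (fst p)(m := snd p)) p) = ?g m (fst p) * ?h (snd p)"
      by simp
  qed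
  finally show ?case .
qed

text \<open>
  Two powers of the weight per coordinate make the lattice sum converge, since the weight
  dominates \<open>1 + \<bar>k i\<bar>\<close> for each \<open>i\<close> separately.
\<close>

lemma summable_on_inverse_weight_power:
  "(\<lambda>k. 1 / weight m k ^ (2 * m)) summable_on exponents m"
proof (rule summable_on_comparison_test[OF summable_on_exponents_prod])
  fix k :: exponent
  have pos: "0 < (\<Prod>i<m. (1 + \<bar>real_of_int (k i)\<bar>)\<^sup>2)"
    by (rule prod_pos) (auto simp: add_pos_nonneg)
  have "(\<Prod>i<m. (1 + \<bar>real_of_int (k i)\<bar>)\<^sup>2) \<le> (\<Prod>i<m. (weight m k)\<^sup>2)"
  proof (rule prod_mono, safe)
    fix i assume "i < m"
    then have "\<bar>real_of_int (k i)\<bar> \<le> (\<Sum>i<m. \<bar>real_of_int (k i)\<bar>)"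
      by (intro member_le_sum[of i "{..<m}" "\<lambda>i. \<bar>real_of_int (k i)\<bar>"]) auto
    then show "(1 + \<bar>real_of_int (k i)\<bar>)\<^sup>2 \<le> (weight m k)\<^sup>2"
      by (intro power_mono) (auto simp: weight_def)
  qed simp
  also have "\<dots> = weight m k ^ (2 * m)"
    by (simp add: power_mult)
  finally show "1 / weight m k ^ (2 * m) \<le> (\<Prod>i<m. 1 / (1 + \<bar>real_of_int (k i)\<bar>)\<^sup>2)"
    using pos by (simp add: prod_dividef frac_le)
  show "0 \<le> 1 / weight m k ^ (2 * m)"
    using weight_ge_1[of m k] by simp
qed

lemma qtorus_decay:
  assumes "a \<in> qtorus m"
  obtains C where "\<And>k. weight m k ^ N * cmod (a k) \<le> C" "0 \<le> C"
proof -
  from assms have out: "\<And>k. k \<notin> exponents m \<Longrightarrow> a k = 0"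
    unfolding qtorus_def by blast
  from assms have "\<exists>C. \<forall>k\<in>exponents m. weight m k ^ N * cmod (a k) \<le> C"
    unfolding qtorus_def weight_def by blast
  then obtain C where C: "\<And>k. k \<in> exponents m \<Longrightarrow> weight m k ^ N * cmod (a k) \<le> C"
    by auto
  have "weight m k ^ N * cmod (a k) \<le> max C 0" for k
    using C[of k] out[of k] by (cases "k \<in> exponents m") auto
  then show ?thesis
    using that[of "max C 0"] by simp
qed

lemma qtorusI:
  assumes "\<And>k. k \<notin> exponents m \<Longrightarrow> a k = 0"
    and "\<And>N. \<exists>C. \<forall>k\<in>exponents m. weight m k ^ N * cmod (a k) \<le> C"
  shows "a \<in> qtorus m"
  using assms by (auto simp: qtorus_def weight_def)

lemma qtorus_support: "a \<in> qtorus m \<Longrightarrow> k \<notin> exponents m \<Longrightarrow> a k = 0"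
  by (simp add: qtorus_def)

text \<open>
  The decay of order \<open>N + 2 * m\<close> pays for the weight \<open>N\<close> and leaves a summable factor.
\<close>

lemma qtorus_weighted_summable:
  assumes "a \<in> qtorus m"
  shows "(\<lambda>k. weight m k ^ N * cmod (a k)) summable_on UNIV"
proof -
  obtain C where C: "\<And>k. weight m k ^ (N + 2 * m) * cmod (a k) \<le> C"
    using qtorus_decay[OF assms] by blast
  have "(\<lambda>k. weight m k ^ N * cmod (a k)) summable_on exponents m"
  proof (rule summable_on_comparison_test)
    show "(\<lambda>k. C * (1 / weight m k ^ (2 * m))) summable_on exponents m"
      by (rule summable_on_cmult_right[OF summable_on_inverse_weight_power])
    fix k :: exponent
    have "0 < weight m k"
      using weight_ge_1[of m k] by simp
    then show "weight m k ^ N * cmod (a k) \<le> C * (1 / weight m k ^ (2 * m))"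
      and "0 \<le> weight m k ^ N * cmod (a k)"
      using C[of k] by (simp_all add: field_simps power_add)
  qed
  then show ?thesis
    by (subst summable_on_cong_neutral[where T = "exponents m"
          and g = "\<lambda>k. weight m k ^ N * cmod (a k)"])
      (auto simp: qtorus_support[OF assms])
qed

corollary qtorus_abs_summable: "a \<in> qtorus m \<Longrightarrow> (\<lambda>k. cmod (a k)) summable_on UNIV"
  using qtorus_weighted_summable[of a m 0] by simp

lemma cmod_qphase [simp]: "cmod (qphase \<Xi> k l) = 1"
  by (simp add: qphase_def)

lemma exponents_add: "k \<in> exponents m \<Longrightarrow> l \<in> exponents m \<Longrightarrow> k + l \<in> exponents m"
  by (auto simp: exponents_def)

lemma qmult_abs_summable:
  assumes "a \<in> qtorus m" "b \<in> qtorus m"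
  shows "(\<lambda>k. cmod (a k * b (r - k) * qphase \<Xi> k (r - k))) summable_on UNIV"
proof -
  obtain C where C: "\<And>k. cmod (b k) \<le> C"
    using qtorus_decay[OF assms(2), of 0] by auto
  show ?thesis
    by (rule summable_on_comparison_test[OF summable_on_cmult_left[OF qtorus_abs_summable[OF assms(1)], of C]])
      (auto simp: norm_mult intro!: mult_left_mono C)
qed

lemma qmult_summable:
  assumes "a \<in> qtorus m" "b \<in> qtorus m"
  shows "(\<lambda>k. a k * b (r - k) * qphase \<Xi> k (r - k)) summable_on UNIV"
  by (rule abs_summable_summable[OF qmult_abs_summable[OF assms]])

text \<open>
  Rapid decay survives the twisted convolution because \<open>weight\<close> is submultiplicative and the phases
  have modulus one: the weight \<open>weight m r ^ N\<close> is absorbed by the two factors separately, the first of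
  which is then summable and the second bounded.
\<close>

lemma qtorus_qmult:
  assumes a: "a \<in> qtorus m" and b: "b \<in> qtorus m"
  shows "qmult \<Xi> a b \<in> qtorus m"
proof (rule qtorusI)
  fix r :: exponent
  assume r: "r \<notin> exponents m"
  have "a k * b (r - k) = 0" for k
    using r exponents_add[of k m "r - k"] qtorus_support[OF a, of k] qtorus_support[OF b, of "r - k"]
    by (cases "k \<in> exponents m \<and> r - k \<in> exponents m") auto
  then have "(\<lambda>k. a k * b (r - k) * qphase \<Xi> k (r - k)) = (\<lambda>k. 0)"
    by (simp only: mult_zero_left)
  then show "qmult \<Xi> a b r = 0"
    by (simp only: qmult_def infsum_0_simp)
next
  fix N
  obtain C where C: "\<And>k. weight m k ^ N * cmod (b k) \<le> C" "0 \<le> C"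
    using qtorus_decay[OF b] by blast
  let ?A = "\<lambda>k. weight m k ^ N * cmod (a k)"
  have "weight m r ^ N * cmod (qmult \<Xi> a b r) \<le> infsum ?A UNIV * C" for r
  proof -
    have "weight m r ^ N * cmod (qmult \<Xi> a b r)
        \<le> weight m r ^ N * (\<Sum>\<^sub>\<infinity>k. cmod (a k * b (r - k) * qphase \<Xi> k (r - k)))"
      unfolding qmult_def
      using weight_ge_1[of m r] norm_infsum_bound[OF qmult_abs_summable[OF a b]]
      by (intro mult_left_mono) auto
    also have "\<dots> = (\<Sum>\<^sub>\<infinity>k. weight m r ^ N * (cmod (a k) * cmod (b (r - k))))"
      by (simp add: infsum_cmult_right' norm_mult)
    also have "\<dots> \<le> (\<Sum>\<^sub>\<infinity>k. ?A k * C)"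
    proof (rule infsum_mono)
      show "(\<lambda>k. weight m r ^ N * (cmod (a k) * cmod (b (r - k)))) summable_on UNIV"
        using qmult_abs_summable[OF a b, of r \<Xi>]
        by (intro summable_on_cmult_right) (simp add: norm_mult)
      show "(\<lambda>k. ?A k * C) summable_on UNIV"
        by (rule summable_on_cmult_left[OF qtorus_weighted_summable[OF a]])
      fix k
      have "weight m r ^ N \<le> (weight m k * weight m (r - k)) ^ N"
        using weight_add_le[of m k "r - k"] weight_ge_1[of m r] by (intro power_mono) auto
      then have "weight m r ^ N * (cmod (a k) * cmod (b (r - k)))
          \<le> (weight m k * weight m (r - k)) ^ N * (cmod (a k) * cmod (b (r - k)))"
        by (rule mult_right_mono) simp
      also have "\<dots> = ?A k * (weight m (r - k) ^ N * cmod (b (r - k)))"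
        by (simp add: power_mult_distrib)
      also have "\<dots> \<le> ?A k * C"
        using weight_ge_1[of m k] by (intro mult_left_mono C) auto
      finally show "weight m r ^ N * (cmod (a k) * cmod (b (r - k))) \<le> ?A k * C" .
    qed
    finally show ?thesis
      by (simp add: infsum_cmult_left')
  qed
  then show "\<exists>B. \<forall>r\<in>exponents m. weight m r ^ N * cmod (qmult \<Xi> a b r) \<le> B"
    by blast
qed

lemma qtorus_zero [simp]: "0 \<in> qtorus m"
  by (rule qtorusI) auto

lemma qtorus_qone [simp]: "qone \<in> qtorus m"
proof (rule qtorusI)
  fix k :: exponent
  assume "k \<notin> exponents m"
  then show "qone k = 0"
    by (auto simp: qone_def qmono_def exponents_def)
next
  fix N
  have "weight m k ^ N * cmod (qone k) \<le> weight m 0 ^ N" for k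
    using weight_ge_1[of m 0] by (auto simp: qone_def qmono_def)
  then show "\<exists>C. \<forall>k\<in>exponents m. weight m k ^ N * cmod (qone k) \<le> C"
    by blast
qed

lemma qtorus_add:
  assumes a: "a \<in> qtorus m" and b: "b \<in> qtorus m"
  shows "a + b \<in> qtorus m"
proof (rule qtorusI)
  fix N
  obtain C where C: "\<And>k. weight m k ^ N * cmod (a k) \<le> C"
    using qtorus_decay[OF a] by blast
  obtain C' where C': "\<And>k. weight m k ^ N * cmod (b k) \<le> C'"
    using qtorus_decay[OF b] by blast
  have "weight m k ^ N * cmod ((a + b) k) \<le> C + C'" for k
  proof -
    have "weight m k ^ N * cmod ((a + b) k) \<le> weight m k ^ N * (cmod (a k) + cmod (b k))"
      using weight_ge_1[of m k] by (intro mult_left_mono) (auto simp: norm_triangle_ineq)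
    then show ?thesis
      using C[of k] C'[of k] by (simp add: distrib_left)
  qed
  then show "\<exists>C. \<forall>k\<in>exponents m. weight m k ^ N * cmod ((a + b) k) \<le> C"
    by blast
qed (simp add: qtorus_support[OF a] qtorus_support[OF b])

lemma qtorus_qscale:
  assumes a: "a \<in> qtorus m"
  shows "qscale c a \<in> qtorus m"
proof (rule qtorusI)
  fix N
  obtain C where C: "\<And>k. weight m k ^ N * cmod (a k) \<le> C"
    using qtorus_decay[OF a] by blast
  have "weight m k ^ N * cmod (qscale c a k) \<le> cmod c * C" for k
    using mult_left_mono[OF C[of k], of "cmod c"] by (simp add: qscale_def norm_mult mult_ac)
  then show "\<exists>C. \<forall>k\<in>exponents m. weight m k ^ N * cmod (qscale c a k) \<le> C"
    by blast
qed (simp add: qscale_def qtorus_support[OF a])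

lemma qtorus_qderiv:
  assumes a: "a \<in> qtorus m" and j: "j < m"
  shows "qderiv j a \<in> qtorus m"
proof (rule qtorusI)
  fix N
  obtain C where C: "\<And>k. weight m k ^ Suc N * cmod (a k) \<le> C"
    using qtorus_decay[OF a] by blast
  have "weight m k ^ N * cmod (qderiv j a k) \<le> 2 * pi * C" for k
  proof -
    have "weight m k ^ N * cmod (qderiv j a k)
        = 2 * pi * (\<bar>real_of_int (k j)\<bar> * (weight m k ^ N * cmod (a k)))"
      by (simp add: qderiv_def norm_mult)
    also have "\<dots> \<le> 2 * pi * (weight m k * (weight m k ^ N * cmod (a k)))"
      using abs_component_le_weight[OF j, of k] weight_ge_1[of m k]
      by (intro mult_left_mono mult_right_mono) auto
    also have "\<dots> \<le> 2 * pi * C"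
      using C[of k] by (intro mult_left_mono) (auto simp: mult.assoc)
    finally show ?thesis .
  qed
  then show "\<exists>C. \<forall>k\<in>exponents m. weight m k ^ N * cmod (qderiv j a k) \<le> C"
    by blast
qed (simp add: qderiv_def qtorus_support[OF a])

lemma qmult_zero_left [simp]: "qmult \<Xi> 0 b = 0"
  and qmult_zero_right [simp]: "qmult \<Xi> a 0 = 0"
  by (auto simp: qmult_def)

lemma qmult_qscale_left: "qmult \<Xi> (qscale c a) b = qscale c (qmult \<Xi> a b)"
  by (rule ext) (simp add: qmult_def qscale_def mult.assoc infsum_cmult_right')

lemma qmult_qscale_right: "qmult \<Xi> a (qscale c b) = qscale c (qmult \<Xi> a b)"
  by (rule ext) (simp add: qmult_def qscale_def mult.assoc mult.left_commute[of _ c] infsum_cmult_right')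

lemma qmult_qone_right [simp]: "qmult \<Xi> a qone = a"
proof
  fix r
  have "qmult \<Xi> a qone r = (\<Sum>\<^sub>\<infinity>k\<in>{r}. a k * qone (r - k) * qphase \<Xi> k (r - k))"
    unfolding qmult_def by (rule infsum_cong_neutral) (auto simp: qone_def qmono_def)
  then show "qmult \<Xi> a qone r = a r"
    by (simp add: qone_def qmono_def qphase_def)
qed

lemma qmult_add_left:
  assumes "a \<in> qtorus m" "a' \<in> qtorus m" "b \<in> qtorus m"
  shows "qmult \<Xi> (a + a') b = qmult \<Xi> a b + qmult \<Xi> a' b"
  using assms
  by (auto simp: fun_eq_iff qmult_def distrib_right infsum_add[OF qmult_summable qmult_summable])

lemma qmult_add_right:
  assumes "a \<in> qtorus m" "b \<in> qtorus m" "b' \<in> qtorus m"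
  shows "qmult \<Xi> a (b + b') = qmult \<Xi> a b + qmult \<Xi> a b'"
  using assms
  by (auto simp: fun_eq_iff qmult_def distrib_left distrib_right infsum_add[OF qmult_summable qmult_summable])

lemma qderiv_qmult:
  assumes a: "a \<in> qtorus m" and b: "b \<in> qtorus m" and j: "j < m"
  shows "qderiv j (qmult \<Xi> a b) = qmult \<Xi> (qderiv j a) b + qmult \<Xi> a (qderiv j b)"
proof
  fix r
  let ?t = "\<lambda>a b k. a k * b (r - k) * qphase \<Xi> k (r - k)"
  have "qderiv j (qmult \<Xi> a b) r = (\<Sum>\<^sub>\<infinity>k. 2 * pi * \<i> * of_int (r j) * ?t a b k)"
    by (simp add: qderiv_def qmult_def infsum_cmult_right')
  also have "\<dots> = (\<Sum>\<^sub>\<infinity>k. ?t (qderiv j a) b k + ?t a (qderiv j b) k)"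
    by (rule infsum_cong) (simp add: qderiv_def algebra_simps)
  also have "\<dots> = infsum (?t (qderiv j a) b) UNIV + infsum (?t a (qderiv j b)) UNIV"
    using a b j by (intro infsum_add qmult_summable[where m = m] qtorus_qderiv)
  finally show "qderiv j (qmult \<Xi> a b) r
      = (qmult \<Xi> (qderiv j a) b + qmult \<Xi> a (qderiv j b)) r"
    by (simp add: qmult_def)
qed

text \<open>
  On exponents of finite support the phase is a bicharacter; this makes it a two-cocycle, which is
  what associativity of the twisted convolution comes down to.
\<close>

lemma qphase_eq:
  assumes "k \<in> exponents m"
  shows "qphase \<Xi> k l = cis (2 * pi * (\<Sum>i<m. \<Sum>j<i. \<Xi> i j * real_of_int (k i) * real_of_int (l j)))"
proof -
  have "{i. k i \<noteq> 0} \<subseteq> {..<m}"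
    using assms by (auto simp: exponents_def simp flip: not_le)
  then have "(\<Sum>i | k i \<noteq> 0. \<Sum>j<i. \<Xi> i j * real_of_int (k i) * real_of_int (l j))
      = (\<Sum>i<m. \<Sum>j<i. \<Xi> i j * real_of_int (k i) * real_of_int (l j))"
    by (intro sum.mono_neutral_left) auto
  then show ?thesis
    by (simp add: qphase_def)
qed

lemma qphase_add_left:
  assumes "k \<in> exponents m" "k' \<in> exponents m"
  shows "qphase \<Xi> (k + k') l = qphase \<Xi> k l * qphase \<Xi> k' l"
  unfolding qphase_eq[OF assms(1)] qphase_eq[OF assms(2)] qphase_eq[OF exponents_add[OF assms]] cis_mult
  by (simp add: algebra_simps sum.distrib)

lemma qphase_add_right:
  assumes "k \<in> exponents m"
  shows "qphase \<Xi> k (l + l') = qphase \<Xi> k l * qphase \<Xi> k l'"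
  unfolding qphase_eq[OF assms] cis_mult
  by (simp add: algebra_simps sum.distrib)

lemma qmult_assoc:
  assumes a: "a \<in> qtorus m" and b: "b \<in> qtorus m" and c: "c \<in> qtorus m"
  shows "qmult \<Xi> (qmult \<Xi> a b) c = qmult \<Xi> a (qmult \<Xi> b c)"
proof
  fix r
  define f where "f = (\<lambda>l k. a l * b (k - l) * qphase \<Xi> l (k - l) * (c (r - k) * qphase \<Xi> k (r - k)))"
  \<comment> \<open>The double sum converges absolutely: \<open>c\<close> is bounded, and after a shear of the index pairs
    what remains is the product of the summable families \<open>a\<close> and \<open>b\<close>.\<close>
  obtain C where C: "\<And>k. cmod (c k) \<le> C" "0 \<le> C"
    using qtorus_decay[OF c, of 0] by auto
  have "(\<lambda>p. cmod (a (fst p)) * cmod (b (snd p))) summable_on UNIV \<times> UNIV"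
  proof (rule summable_on_SigmaI)
    show "((\<lambda>y. cmod (a (fst (x, y))) * cmod (b (snd (x, y)))) has_sum
        cmod (a x) * (\<Sum>\<^sub>\<infinity>y. cmod (b y))) UNIV" for x
      using qtorus_abs_summable[OF b] by (auto intro!: has_sum_cmult_right)
    show "(\<lambda>x. cmod (a x) * (\<Sum>\<^sub>\<infinity>y. cmod (b y))) summable_on UNIV"
      using qtorus_abs_summable[OF a] by (rule summable_on_cmult_left)
  qed auto
  then have "(\<lambda>p. cmod (a (fst p)) * cmod (b (snd p - fst p))) summable_on UNIV \<times> UNIV"
    by (subst summable_on_reindex_bij_witness[where i = "\<lambda>p. (fst p, snd p + fst p)"
          and j = "\<lambda>p. (fst p, snd p - fst p)" and T = "UNIV \<times> UNIV"
          and h = "\<lambda>p. cmod (a (fst p)) * cmod (b (snd p))"]) auto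
  then have "(\<lambda>p. cmod (a (fst p)) * cmod (b (snd p - fst p)) * C) summable_on UNIV \<times> UNIV"
    by (rule summable_on_cmult_left)
  then have "(\<lambda>p. cmod (case p of (l, k) \<Rightarrow> f l k)) summable_on UNIV \<times> UNIV"
    by (rule summable_on_comparison_test)
      (auto simp: f_def norm_mult intro!: mult_left_mono C)
  then have sum: "(\<lambda>(l, k). f l k) summable_on UNIV \<times> UNIV"
    by (rule abs_summable_summable)
  have "qmult \<Xi> (qmult \<Xi> a b) c r = (\<Sum>\<^sub>\<infinity>k. \<Sum>\<^sub>\<infinity>l. f l k)"
    by (simp add: qmult_def f_def mult.assoc flip: infsum_cmult_left')
  also have "\<dots> = (\<Sum>\<^sub>\<infinity>l. \<Sum>\<^sub>\<infinity>k. f l k)"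
    by (rule infsum_swap_banach[OF sum, symmetric])
  also have "\<dots> = (\<Sum>\<^sub>\<infinity>l. \<Sum>\<^sub>\<infinity>j. a l * (b j * c (r - l - j) * qphase \<Xi> j (r - l - j)) * qphase \<Xi> l (r - l))"
  proof (rule infsum_cong)
    fix l
    \<comment> \<open>The substitution \<open>k = l + j\<close> makes \<open>j\<close> the exponent taken from \<open>b\<close>.\<close>
    have "(\<Sum>\<^sub>\<infinity>k. f l k) = (\<Sum>\<^sub>\<infinity>j. f l (l + j))"
      by (rule infsum_reindex_bij_witness[where j = "\<lambda>k. k - l" and i = "\<lambda>j. l + j"]) auto
    also have "\<dots> = (\<Sum>\<^sub>\<infinity>j. a l * (b j * c (r - l - j) * qphase \<Xi> j (r - l - j)) * qphase \<Xi> l (r - l))"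
    proof (rule infsum_cong)
      fix j
      show "f l (l + j) = a l * (b j * c (r - l - j) * qphase \<Xi> j (r - l - j)) * qphase \<Xi> l (r - l)"
      proof (cases "l \<in> exponents m \<and> j \<in> exponents m")
        case True
        have "qphase \<Xi> l (r - l) = qphase \<Xi> l j * qphase \<Xi> l (r - (l + j))"
          using qphase_add_right[of l m \<Xi> j "r - (l + j)"] True by (simp add: algebra_simps)
        then show ?thesis
          using True by (simp add: f_def qphase_add_left[of l m j] diff_diff_eq mult_ac)
      next
        case False
        then show ?thesis
          using qtorus_support[OF a] qtorus_support[OF b] by (auto simp: f_def)
      qed
    qed
    finally show "(\<Sum>\<^sub>\<infinity>k. f l k) = \<dots>" .
  qed
  also have "\<dots> = qmult \<Xi> a (qmult \<Xi> b c) r"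
    by (simp add: qmult_def infsum_cmult_left' infsum_cmult_right')
  finally show "qmult \<Xi> (qmult \<Xi> a b) c r = qmult \<Xi> a (qmult \<Xi> b c) r" .
qed

section \<open>The graded algebra of forms\<close>

lemma sum_fun_apply: "(\<Sum>i\<in>A. f i) x = (\<Sum>i\<in>A. f i x)"
  for f :: "'i \<Rightarrow> 'a \<Rightarrow> 'b::comm_monoid_add"
  by (induction A rule: infinite_finite_induct) simp_all

lemma qscale_zero [simp]: "qscale c 0 = 0" "qscale 0 a = 0"
  and qscale_one [simp]: "qscale 1 a = a"
  and qscale_qscale [simp]: "qscale c (qscale d a) = qscale (c * d) a"
  and qscale_add: "qscale c (a + b) = qscale c a + qscale c b"
  by (auto simp: qscale_def fun_eq_iff algebra_simps)

lemma qscale_sum: "qscale c (\<Sum>i\<in>A. f i) = (\<Sum>i\<in>A. qscale c (f i))"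
  by (rule ext) (simp add: qscale_def sum_fun_apply sum_distrib_left)

lemma qderiv_zero [simp]: "qderiv j 0 = 0"
  and qderiv_qone [simp]: "qderiv j qone = 0"
  and qderiv_add: "qderiv j (a + b) = qderiv j a + qderiv j b"
  and qderiv_qscale: "qderiv j (qscale c a) = qscale c (qderiv j a)"
  by (auto simp: qderiv_def qscale_def qone_def qmono_def fun_eq_iff algebra_simps)

lemma qderiv_sum: "qderiv j (\<Sum>i\<in>A. f i) = (\<Sum>i\<in>A. qderiv j (f i))"
  by (rule ext) (simp add: qderiv_def sum_fun_apply sum_distrib_left)

lemma qderiv_commute: "qderiv i (qderiv j a) = qderiv j (qderiv i a)"
  by (simp add: qderiv_def fun_eq_iff)

lemma qtorus_sum: "(\<And>i. i \<in> A \<Longrightarrow> f i \<in> qtorus m) \<Longrightarrow> (\<Sum>i\<in>A. f i) \<in> qtorus m"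
  by (induction A rule: infinite_finite_induct) (simp_all add: qtorus_add)

lemma qmult_sum_left:
  assumes "\<And>i. i \<in> A \<Longrightarrow> f i \<in> qtorus m" "b \<in> qtorus m"
  shows "qmult \<Xi> (\<Sum>i\<in>A. f i) b = (\<Sum>i\<in>A. qmult \<Xi> (f i) b)"
  using assms
  by (induction A rule: infinite_finite_induct) (simp_all add: qmult_add_left[where m = m] qtorus_sum)

lemma qmult_sum_right:
  assumes "\<And>i. i \<in> A \<Longrightarrow> f i \<in> qtorus m" "b \<in> qtorus m"
  shows "qmult \<Xi> b (\<Sum>i\<in>A. f i) = (\<Sum>i\<in>A. qmult \<Xi> b (f i))"
  using assms
  by (induction A rule: infinite_finite_induct) (simp_all add: qmult_add_right[where m = m] qtorus_sum)

lemma formsD: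
  assumes "\<omega> \<in> forms m"
  shows forms_coeff: "\<omega> I \<in> qtorus m" and forms_support: "\<not> I \<subseteq> {..<m} \<Longrightarrow> \<omega> I = 0"
  using assms by (auto simp: forms_def)

lemma forms_zero [simp]: "0 \<in> forms m"
  and forms_add: "\<omega> \<in> forms m \<Longrightarrow> \<eta> \<in> forms m \<Longrightarrow> \<omega> + \<eta> \<in> forms m"
  and forms_fscale: "\<omega> \<in> forms m \<Longrightarrow> fscale c \<omega> \<in> forms m"
  and forms_felem: "x \<in> qtorus m \<Longrightarrow> I \<subseteq> {..<m} \<Longrightarrow> felem x I \<in> forms m"
  by (auto simp: forms_def qtorus_add qtorus_qscale fscale_def felem_def)

lemma forms_sum: "(\<And>i. i \<in> A \<Longrightarrow> f i \<in> forms m) \<Longrightarrow> (\<Sum>i\<in>A. f i) \<in> forms m"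
  by (induction A rule: infinite_finite_induct) (simp_all add: forms_add)

lemma forms_fmult:
  assumes \<omega>: "\<omega> \<in> forms m" and \<eta>: "\<eta> \<in> forms m"
  shows "fmult \<Xi> \<omega> \<eta> \<in> forms m"
proof -
  have "fmult \<Xi> \<omega> \<eta> K \<in> qtorus m" for K
    unfolding fmult_def using \<omega> \<eta>
    by (intro qtorus_sum qtorus_qscale qtorus_qmult forms_coeff)
  moreover have "fmult \<Xi> \<omega> \<eta> K = 0" if K: "\<not> K \<subseteq> {..<m}" for K
    unfolding fmult_def
  proof (intro sum.neutral ballI)
    fix I assume "I \<in> Pow K"
    then have "\<not> I \<subseteq> {..<m} \<or> \<not> K - I \<subseteq> {..<m}"
      using K by blast
    then have "\<omega> I = 0 \<or> \<eta> (K - I) = 0"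
      using forms_support[OF \<omega>, of I] forms_support[OF \<eta>, of "K - I"] by argo
    then show "qscale (wedge_sign I (K - I)) (qmult \<Xi> (\<omega> I) (\<eta> (K - I))) = 0"
      by auto
  qed
  ultimately show ?thesis
    by (simp add: forms_def)
qed

lemma forms_deg_fmult:
  assumes \<omega>: "\<omega> \<in> forms_deg m k" and \<eta>: "\<eta> \<in> forms_deg m l"
  shows "fmult \<Xi> \<omega> \<eta> \<in> forms_deg m (k + l)"
proof -
  have "fmult \<Xi> \<omega> \<eta> K = 0" if K: "card K \<noteq> k + l" for K
  proof (cases "finite K")
    case True
    show ?thesis
      unfolding fmult_def
    proof (intro sum.neutral ballI)
      fix I assume I: "I \<in> Pow K"
      then have "card I + card (K - I) = card K"
        using True by (metis PowD add_diff_cancel_left' card_Diff_subset card_mono finite_subset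
            le_add_diff_inverse)
      then have "card I \<noteq> k \<or> card (K - I) \<noteq> l"
        using K by linarith
      then show "qscale (wedge_sign I (K - I)) (qmult \<Xi> (\<omega> I) (\<eta> (K - I))) = 0"
        using \<omega> \<eta> by (auto simp: forms_deg_def)
    qed
  qed (simp add: fmult_def)
  then show ?thesis
    using \<omega> \<eta> by (simp add: forms_deg_def forms_fmult)
qed

lemma fmult_zero [simp]: "fmult \<Xi> 0 \<eta> = 0" "fmult \<Xi> \<omega> 0 = 0"
  by (simp_all add: fmult_def fun_eq_iff)

lemma fmult_add_left:
  assumes "\<omega> \<in> forms m" "\<omega>' \<in> forms m" "\<eta> \<in> forms m"
  shows "fmult \<Xi> (\<omega> + \<omega>') \<eta> = fmult \<Xi> \<omega> \<eta> + fmult \<Xi> \<omega>' \<eta>"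
  by (rule ext) (simp add: fmult_def qmult_add_left[OF assms[THEN forms_coeff]] qscale_add sum.distrib)

lemma fmult_add_right:
  assumes "\<omega> \<in> forms m" "\<eta> \<in> forms m" "\<eta>' \<in> forms m"
  shows "fmult \<Xi> \<omega> (\<eta> + \<eta>') = fmult \<Xi> \<omega> \<eta> + fmult \<Xi> \<omega> \<eta>'"
  by (rule ext) (simp add: fmult_def qmult_add_right[OF assms[THEN forms_coeff]] qscale_add sum.distrib)

lemma fmult_fscale_left: "fmult \<Xi> (fscale c \<omega>) \<eta> = fscale c (fmult \<Xi> \<omega> \<eta>)"
  and fmult_fscale_right: "fmult \<Xi> \<omega> (fscale c \<eta>) = fscale c (fmult \<Xi> \<omega> \<eta>)"
  by (auto simp: fmult_def fscale_def qmult_qscale_left qmult_qscale_right qscale_sum mult.commute)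

lemma fmult_sum_left:
  assumes "\<And>i. i \<in> A \<Longrightarrow> f i \<in> forms m" "\<eta> \<in> forms m"
  shows "fmult \<Xi> (\<Sum>i\<in>A. f i) \<eta> = (\<Sum>i\<in>A. fmult \<Xi> (f i) \<eta>)"
  using assms
  by (induction A rule: infinite_finite_induct) (simp_all add: fmult_add_left[where m = m] forms_sum)

lemma fmult_sum_right:
  assumes "\<And>i. i \<in> A \<Longrightarrow> f i \<in> forms m" "\<eta> \<in> forms m"
  shows "fmult \<Xi> \<eta> (\<Sum>i\<in>A. f i) = (\<Sum>i\<in>A. fmult \<Xi> \<eta> (f i))"
  using assms
  by (induction A rule: infinite_finite_induct) (simp_all add: fmult_add_right[where m = m] forms_sum)

lemma fscale_one [simp]: "fscale 1 \<omega> = \<omega>"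
  and fscale_zero [simp]: "fscale c 0 = 0"
  and fscale_fscale: "fscale c (fscale d \<omega>) = fscale (c * d) \<omega>"
  and fscale_add: "fscale c (\<omega> + \<eta>) = fscale c \<omega> + fscale c \<eta>"
  and fscale_add_left: "fscale (c + d) \<omega> = fscale c \<omega> + fscale d \<omega>"
  and fscale_minus_one: "fscale (- 1) \<omega> = - \<omega>"
  by (auto simp: fscale_def qscale_def fun_eq_iff algebra_simps)

lemma fscale_sum: "fscale c (\<Sum>i\<in>A. f i) = (\<Sum>i\<in>A. fscale c (f i))"
  by (rule ext) (simp add: fscale_def sum_fun_apply qscale_sum)

lemma wedge_sign_empty [simp]: "wedge_sign {} J = 1" "wedge_sign I {} = 1"
  by (simp_all add: wedge_sign_def)

lemma wedge_sign_Un_left: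
  assumes "finite I" "finite J" "finite C" "I \<inter> J = {}"
  shows "wedge_sign (I \<union> J) C = wedge_sign I C * wedge_sign J C"
proof -
  let ?S = "\<lambda>I. {(i, j). i \<in> I \<and> j \<in> C \<and> j < i}"
  have "?S (I \<union> J) = ?S I \<union> ?S J"
    by auto
  moreover have "finite (?S I)" "finite (?S J)"
    using assms by (auto intro: finite_subset[of _ "I \<times> C"] finite_subset[of _ "J \<times> C"])
  moreover have "?S I \<inter> ?S J = {}"
    using assms(4) by auto
  ultimately have "card (?S (I \<union> J)) = card (?S I) + card (?S J)"
    by (simp only: card_Un_disjoint)
  then show ?thesis
    by (simp only: wedge_sign_def power_add)
qed

lemma wedge_sign_Un_right:
  assumes "finite I" "finite J" "finite C" "J \<inter> C = {}"
  shows "wedge_sign I (J \<union> C) = wedge_sign I J * wedge_sign I C"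
proof -
  let ?S = "\<lambda>J. {(i, j). i \<in> I \<and> j \<in> J \<and> j < i}"
  have "?S (J \<union> C) = ?S J \<union> ?S C"
    by auto
  moreover have "finite (?S J)" "finite (?S C)"
    using assms by (auto intro: finite_subset[of _ "I \<times> J"] finite_subset[of _ "I \<times> C"])
  moreover have "?S J \<inter> ?S C = {}"
    using assms(4) by auto
  ultimately have "card (?S (J \<union> C)) = card (?S J) + card (?S C)"
    by (simp only: card_Un_disjoint)
  then show ?thesis
    by (simp only: wedge_sign_def power_add)
qed

lemma wedge_sign_singleton:
  assumes "finite I" "j \<notin> I"
  shows "wedge_sign I {j} = (- 1) ^ card I * wedge_sign {j} I"
proof -
  have "{(i, b). i \<in> I \<and> b \<in> {j} \<and> b < i} = (\<lambda>i. (i, j)) ` {i \<in> I. j < i}"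
    by auto
  then have above: "wedge_sign I {j} = (- 1) ^ card {i \<in> I. j < i}"
    by (simp only: wedge_sign_def) (simp add: card_image inj_on_def)
  have "{(a, b). a \<in> {j} \<and> b \<in> I \<and> b < a} = Pair j ` {i \<in> I. i < j}"
    by auto
  then have below: "wedge_sign {j} I = (- 1) ^ card {i \<in> I. i < j}"
    by (simp only: wedge_sign_def) (simp add: card_image inj_on_def)
  have "j < i \<or> i < j" if "i \<in> I" for i
    using assms(2) that by (metis linorder_neqE_nat)
  then have "I = {i \<in> I. j < i} \<union> {i \<in> I. i < j}"
    by blast
  then have "card I = card ({i \<in> I. j < i} \<union> {i \<in> I. i < j})"
    by (rule arg_cong)
  also have "\<dots> = card {i \<in> I. j < i} + card {i \<in> I. i < j}"
  proof (rule card_Un_disjoint)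
    show "finite {i \<in> I. j < i}"
      by (rule finite_subset[OF _ assms(1)]) blast
    show "finite {i \<in> I. i < j}"
      by (rule finite_subset[OF _ assms(1)]) blast
    show "{i \<in> I. j < i} \<inter> {i \<in> I. i < j} = {}"
      using less_asym by blast
  qed
  finally show ?thesis
    unfolding above below by (simp add: power_add mult.assoc)
qed

text \<open>
  Both bracketings are sums over the ordered splittings of the index set into three parts; the signs
  agree since each of them is the product of the three pairwise signs.
\<close>

lemma fmult_assoc:
  assumes \<omega>: "\<omega> \<in> forms m" and \<eta>: "\<eta> \<in> forms m" and \<zeta>: "\<zeta> \<in> forms m"
  shows "fmult \<Xi> (fmult \<Xi> \<omega> \<eta>) \<zeta> = fmult \<Xi> \<omega> (fmult \<Xi> \<eta> \<zeta>)"
proof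
  fix K
  note q = qtorus_qscale qtorus_qmult forms_coeff[OF \<omega>] forms_coeff[OF \<eta>] forms_coeff[OF \<zeta>]
  show "fmult \<Xi> (fmult \<Xi> \<omega> \<eta>) \<zeta> K = fmult \<Xi> \<omega> (fmult \<Xi> \<eta> \<zeta>) K"
  proof (cases "finite K")
    case fin: True
    have finA: "finite A" if "A \<subseteq> K" for A
      using fin that by (rule rev_finite_subset)
    let ?l = "\<lambda>(A, I). qscale (wedge_sign A (K - A) * wedge_sign I (A - I))
        (qmult \<Xi> (qmult \<Xi> (\<omega> I) (\<eta> (A - I))) (\<zeta> (K - A)))"
    let ?r = "\<lambda>(I, J). qscale (wedge_sign I (K - I) * wedge_sign J (K - I - J))
        (qmult \<Xi> (\<omega> I) (qmult \<Xi> (\<eta> J) (\<zeta> (K - I - J))))"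
    have "fmult \<Xi> (fmult \<Xi> \<omega> \<eta>) \<zeta> K = (\<Sum>A\<in>Pow K. \<Sum>I\<in>Pow A. ?l (A, I))"
      unfolding fmult_def
      by (intro sum.cong refl)
        (simp add: qmult_sum_left[where m = m] q qmult_qscale_left qscale_sum)
    also have "\<dots> = sum ?l (SIGMA A:Pow K. Pow A)"
      using fin finA by (subst sum.Sigma) auto
    also have "\<dots> = sum ?r (SIGMA I:Pow K. Pow (K - I))"
    proof (rule sum.reindex_bij_witness[where i = "\<lambda>(I, J). (I \<union> J, I)" and j = "\<lambda>(A, I). (I, A - I)"])
      fix p assume "p \<in> (SIGMA A:Pow K. Pow A)"
      then obtain A I where p: "p = (A, I)" and A: "A \<subseteq> K" "I \<subseteq> A"
        by auto
      define J C where "J = A - I" and "C = K - A"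
      have sets: "A = I \<union> J" "A - I = J" "K - A = C" "K - I = J \<union> C" "K - I - J = C" "J \<union> C - J = C"
        and disj: "I \<inter> J = {}" "J \<inter> C = {}"
        using A by (auto simp: J_def C_def)
      have fins: "finite I" "finite J" "finite C"
        using finA A fin by (auto simp: J_def C_def)
      have "wedge_sign A (K - A) * wedge_sign I (A - I)
          = wedge_sign I (K - I) * wedge_sign J (K - I - J)"
        unfolding sets(2-6) unfolding sets(1) wedge_sign_Un_left[OF fins disj(1)]
          wedge_sign_Un_right[OF fins disj(2)] by simp
      then show "?r ((\<lambda>(A, I). (I, A - I)) p) = ?l p"
        by (simp add: p sets(2-6) qmult_assoc[OF q(3-5)])
    qed auto
    also have "\<dots> = (\<Sum>I\<in>Pow K. \<Sum>J\<in>Pow (K - I). ?r (I, J))"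
      using fin by (subst sum.Sigma) auto
    also have "\<dots> = fmult \<Xi> \<omega> (fmult \<Xi> \<eta> \<zeta>) K"
      unfolding fmult_def
      by (intro sum.cong refl)
        (simp add: qmult_sum_right[where m = m] q qmult_qscale_right qscale_sum)
    finally show ?thesis .
  qed (simp add: fmult_def)
qed

lemma fmult_form0_left:
  assumes "\<omega> \<in> forms m"
  shows "fmult \<Xi> (form0 b) \<omega> = (\<lambda>K. qmult \<Xi> b (\<omega> K))"
proof
  fix K
  show "fmult \<Xi> (form0 b) \<omega> K = qmult \<Xi> b (\<omega> K)"
  proof (cases "finite K")
    case True
    have "fmult \<Xi> (form0 b) \<omega> K = (\<Sum>I\<in>{{}}. qscale (wedge_sign I (K - I)) (qmult \<Xi> (form0 b I) (\<omega> (K - I))))"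
      unfolding fmult_def using True by (intro sum.mono_neutral_right) (auto simp: felem_def)
    then show ?thesis
      by (simp add: felem_def)
  next
    case False
    then have "\<not> K \<subseteq> {..<m}"
      using finite_subset by blast
    with False show ?thesis
      using forms_support[OF assms] by (simp add: fmult_def)
  qed
qed

lemma fmult_form0_right:
  assumes "\<omega> \<in> forms m"
  shows "fmult \<Xi> \<omega> (form0 b) = (\<lambda>K. qmult \<Xi> (\<omega> K) b)"
proof
  fix K
  show "fmult \<Xi> \<omega> (form0 b) K = qmult \<Xi> (\<omega> K) b"
  proof (cases "finite K")
    case True
    have "fmult \<Xi> \<omega> (form0 b) K = (\<Sum>I\<in>{K}. qscale (wedge_sign I (K - I)) (qmult \<Xi> (\<omega> I) (form0 b (K - I))))"
      unfolding fmult_def using True by (intro sum.mono_neutral_right) (auto simp: felem_def)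
    then show ?thesis
      by (simp add: felem_def)
  next
    case False
    then have "\<not> K \<subseteq> {..<m}"
      using finite_subset by blast
    with False show ?thesis
      using forms_support[OF assms] by (simp add: fmult_def)
  qed
qed

lemma fmult_form0_qone [simp]:
  assumes "\<omega> \<in> forms m"
  shows "fmult \<Xi> (form0 qone) \<omega> = \<omega>" "fmult \<Xi> \<omega> (form0 qone) = \<omega>"
  by (simp_all add: fmult_form0_left[OF assms] fmult_form0_right[OF assms])

text \<open>
  The rule \<open>(x \<otimes> e\<^sub>A)(y \<otimes> e\<^sub>B) = \<plusminus> xy \<otimes> e\<^bsub>A \<union> B\<^esub>\<close>; together with the decomposition of a form into its
  components it reduces identities that are additive in a form to signs.
\<close>

lemma fmult_felem:
  assumes "finite A" "finite B"
  shows "fmult \<Xi> (felem x A) (felem y B)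
    = (if A \<inter> B = {} then felem (qscale (wedge_sign A B) (qmult \<Xi> x y)) (A \<union> B) else 0)"
proof
  fix K
  let ?t = "\<lambda>I. qscale (wedge_sign I (K - I)) (qmult \<Xi> (felem x A I) (felem y B (K - I)))"
  have "fmult \<Xi> (felem x A) (felem y B) K = (if A \<inter> B = {} \<and> K = A \<union> B
      then qscale (wedge_sign A B) (qmult \<Xi> x y) else 0)"
  proof (cases "A \<inter> B = {} \<and> K = A \<union> B")
    case True
    then have "K - A = B" "finite K" "A \<subseteq> K"
      using assms by auto
    then have "fmult \<Xi> (felem x A) (felem y B) K = (\<Sum>I\<in>{A}. ?t I)"
      unfolding fmult_def by (intro sum.mono_neutral_right) (auto simp: felem_def)
    with \<open>K - A = B\<close> True show ?thesis
      by (simp add: felem_def)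
  next
    case False
    then have "?t I = 0" if "I \<subseteq> K" for I
      using that by (auto simp: felem_def)
    with False show ?thesis
      by (auto simp: fmult_def)
  qed
  then show "fmult \<Xi> (felem x A) (felem y B) K =
      (if A \<inter> B = {} then felem (qscale (wedge_sign A B) (qmult \<Xi> x y)) (A \<union> B) else 0) K"
    by (auto simp: felem_def)
qed

lemma form_eq_sum_felem:
  assumes "\<omega> \<in> forms m"
  shows "\<omega> = (\<Sum>I\<in>Pow {..<m}. felem (\<omega> I) I)"
proof
  fix K
  have "(\<Sum>I\<in>Pow {..<m}. felem (\<omega> I) I) K = (\<Sum>I\<in>Pow {..<m}. if K = I then \<omega> I else 0)"
    by (simp add: sum_fun_apply felem_def)
  also have "\<dots> = \<omega> K"
    using forms_support[OF assms, of K] by (simp add: sum.delta')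
  finally show "\<omega> K = (\<Sum>I\<in>Pow {..<m}. felem (\<omega> I) I) K" ..
qed

section \<open>The exterior derivative\<close>

text \<open>The factor \<open>\<i>\<close> is the one in \<open>dx = i \<Sum>\<^sub>j \<delta>\<^sub>j(x) dU\<^sub>j\<close>.\<close>

definition fpartial :: "nat \<Rightarrow> qform \<Rightarrow> qform" where
  "fpartial j \<omega> = (\<lambda>I. qscale \<i> (qderiv j (\<omega> I)))"

abbreviation dU :: "nat \<Rightarrow> qform" where
  "dU j \<equiv> felem qone {j}"

lemma forms_fpartial: "\<omega> \<in> forms m \<Longrightarrow> j < m \<Longrightarrow> fpartial j \<omega> \<in> forms m"
  by (auto simp: forms_def fpartial_def qtorus_qscale qtorus_qderiv)

lemma forms_dU: "j < m \<Longrightarrow> dU j \<in> forms m"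
  by (rule forms_felem) auto

lemma fpartial_dU [simp]: "fpartial j (dU i) = 0"
  by (auto simp: fpartial_def felem_def)

lemma fpartial_add: "fpartial j (\<omega> + \<eta>) = fpartial j \<omega> + fpartial j \<eta>"
  by (rule ext) (simp add: fpartial_def qderiv_add qscale_add)

lemma fpartial_sum: "fpartial j (\<Sum>i\<in>A. f i) = (\<Sum>i\<in>A. fpartial j (f i))"
  by (rule ext) (simp add: fpartial_def sum_fun_apply qderiv_sum qscale_sum)

lemma fpartial_commute: "fpartial i (fpartial j \<omega>) = fpartial j (fpartial i \<omega>)"
  by (auto simp: fpartial_def qderiv_qscale qderiv_commute[of i j])

lemma fpartial_fmult:
  assumes "\<omega> \<in> forms m" "\<eta> \<in> forms m" "j < m"
  shows "fpartial j (fmult \<Xi> \<omega> \<eta>) = fmult \<Xi> (fpartial j \<omega>) \<eta> + fmult \<Xi> \<omega> (fpartial j \<eta>)"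
  by (rule ext) (simp add: fpartial_def fmult_def qderiv_sum qderiv_qscale qderiv_add
      qderiv_qmult[OF assms(1)[THEN forms_coeff] assms(2)[THEN forms_coeff] assms(3)]
      qscale_sum qscale_add qmult_qscale_left qmult_qscale_right mult.commute sum.distrib)

text \<open>
  Written as \<open>\<Sum>\<^sub>j dU\<^sub>j \<partial>\<^sub>j\<close>, with commuting derivations \<open>\<partial>\<^sub>j\<close> that kill the \<open>dU\<^sub>i\<close>, the exterior
  derivative obeys its usual rules for the usual reasons.
\<close>

lemma ext_d_eq:
  assumes \<omega>: "\<omega> \<in> forms m"
  shows "ext_d \<Xi> m \<omega> = (\<Sum>j<m. fmult \<Xi> (dU j) (fpartial j \<omega>))"
proof -
  have "ext_d \<Xi> m \<omega> = (\<Sum>I\<in>Pow {..<m}. \<Sum>j<m. fmult \<Xi> (dU j) (felem (fpartial j \<omega> I) I))"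
    unfolding ext_d_def
  proof (rule sum.cong[OF refl])
    fix I assume I: "I \<in> Pow {..<m}"
    then have fin: "finite I"
      using finite_subset by auto
    have "fmult \<Xi> (d0 m (\<omega> I)) (felem qone I)
        = (\<Sum>j<m. fmult \<Xi> (felem (qscale \<i> (qderiv j (\<omega> I))) {j}) (felem qone I))"
      unfolding d0_def
      by (intro fmult_sum_left[where m = m] forms_felem qtorus_qscale qtorus_qderiv forms_coeff[OF \<omega>])
        (use I in auto)
    also have "\<dots> = (\<Sum>j<m. fmult \<Xi> (dU j) (felem (fpartial j \<omega> I) I))"
      by (intro sum.cong refl) (simp add: fmult_felem fin fpartial_def)
    finally show "fmult \<Xi> (d0 m (\<omega> I)) (felem qone I)
        = (\<Sum>j<m. fmult \<Xi> (dU j) (felem (fpartial j \<omega> I) I))" .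
  qed
  also have "\<dots> = (\<Sum>j<m. \<Sum>I\<in>Pow {..<m}. fmult \<Xi> (dU j) (felem (fpartial j \<omega> I) I))"
    by (rule sum.swap)
  also have "\<dots> = (\<Sum>j<m. fmult \<Xi> (dU j) (fpartial j \<omega>))"
  proof (rule sum.cong[OF refl])
    fix j assume "j \<in> {..<m}"
    then have p: "fpartial j \<omega> \<in> forms m" and u: "dU j \<in> forms m"
      using forms_fpartial[OF \<omega>] forms_dU by auto
    have "(\<Sum>I\<in>Pow {..<m}. fmult \<Xi> (dU j) (felem (fpartial j \<omega> I) I))
        = fmult \<Xi> (dU j) (\<Sum>I\<in>Pow {..<m}. felem (fpartial j \<omega> I) I)"
      by (rule fmult_sum_right[symmetric, where m = m]) (auto intro!: forms_felem forms_coeff[OF p] u)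
    then show "(\<Sum>I\<in>Pow {..<m}. fmult \<Xi> (dU j) (felem (fpartial j \<omega> I) I))
        = fmult \<Xi> (dU j) (fpartial j \<omega>)"
      by (simp flip: form_eq_sum_felem[OF p])
  qed
  finally show ?thesis .
qed

lemma forms_ext_d: "\<omega> \<in> forms m \<Longrightarrow> ext_d \<Xi> m \<omega> \<in> forms m"
  by (auto simp: ext_d_eq intro!: forms_sum forms_fmult forms_dU forms_fpartial)

lemma forms_deg_ext_d:
  assumes "\<omega> \<in> forms_deg m k"
  shows "ext_d \<Xi> m \<omega> \<in> forms_deg m (Suc k)"
proof -
  have \<omega>: "\<omega> \<in> forms m"
    using assms by (simp add: forms_deg_def)
  have "fmult \<Xi> (dU j) (fpartial j \<omega>) \<in> forms_deg m (1 + k)" if "j < m" for j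
  proof (rule forms_deg_fmult)
    show "dU j \<in> forms_deg m 1"
      using forms_dU[OF that] by (auto simp: forms_deg_def felem_def)
    show "fpartial j \<omega> \<in> forms_deg m k"
      using forms_fpartial[OF \<omega> that] assms by (auto simp: forms_deg_def fpartial_def)
  qed
  then show ?thesis
    using forms_ext_d[OF \<omega>] by (simp add: ext_d_eq[OF \<omega>] forms_deg_def sum_fun_apply)
qed

lemma ext_d_add:
  assumes "\<omega> \<in> forms m" "\<eta> \<in> forms m"
  shows "ext_d \<Xi> m (\<omega> + \<eta>) = ext_d \<Xi> m \<omega> + ext_d \<Xi> m \<eta>"
  unfolding ext_d_eq[OF assms(1)] ext_d_eq[OF assms(2)] ext_d_eq[OF forms_add[OF assms]]
  by (simp add: fpartial_add fmult_add_right[where m = m] forms_dU forms_fpartial assms sum.distrib)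

text \<open>
  Moving \<open>dU\<^sub>j\<close> past \<open>e\<^sub>I\<close> costs one sign for each element of \<open>I\<close>,
  whether it lies above or below \<open>j\<close>, and both products vanish when \<open>j \<in> I\<close>.
\<close>

lemma fmult_dU_commute:
  assumes \<omega>: "\<omega> \<in> forms_deg m k" and j: "j < m"
  shows "fmult \<Xi> \<omega> (dU j) = fscale ((- 1) ^ k) (fmult \<Xi> (dU j) \<omega>)"
proof -
  have f: "\<omega> \<in> forms m"
    using \<omega> by (simp add: forms_deg_def)
  have e: "felem (\<omega> I) I \<in> forms m" if "I \<in> Pow {..<m}" for I
    using that by (auto intro!: forms_felem forms_coeff[OF f])
  have "fmult \<Xi> \<omega> (dU j) = (\<Sum>I\<in>Pow {..<m}. fmult \<Xi> (felem (\<omega> I) I) (dU j))"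
    by (subst form_eq_sum_felem[OF f]) (intro fmult_sum_left[where m = m] e forms_dU j)
  also have "\<dots> = (\<Sum>I\<in>Pow {..<m}. fscale ((- 1) ^ k) (fmult \<Xi> (dU j) (felem (\<omega> I) I)))"
  proof (rule sum.cong[OF refl])
    fix I assume "I \<in> Pow {..<m}"
    then have fin: "finite I"
      using finite_subset by auto
    have z: "felem 0 A = 0" for A
      by (auto simp: felem_def)
    have s: "fscale c (felem x A) = felem (qscale c x) A" for c x A
      by (auto simp: felem_def fscale_def)
    show "fmult \<Xi> (felem (\<omega> I) I) (dU j) = fscale ((- 1) ^ k) (fmult \<Xi> (dU j) (felem (\<omega> I) I))"
    proof (cases "card I = k \<and> j \<notin> I")
      case True
      then show ?thesis
        using wedge_sign_singleton[OF fin, of j] by (simp add: fmult_felem fin s)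
    next
      case False
      then show ?thesis
        using \<omega> by (auto simp: fmult_felem fin z forms_deg_def)
    qed
  qed
  also have "\<dots> = fscale ((- 1) ^ k) (fmult \<Xi> (dU j) (\<Sum>I\<in>Pow {..<m}. felem (\<omega> I) I))"
    by (subst fmult_sum_right[where m = m]) (auto simp: fscale_sum intro!: e forms_dU j)
  also have "\<dots> = fscale ((- 1) ^ k) (fmult \<Xi> (dU j) \<omega>)"
    by (simp flip: form_eq_sum_felem[OF f])
  finally show ?thesis .
qed

text \<open>
  Each \<open>\<partial>\<^sub>j\<close> is an ungraded derivation; the sign appears when \<open>dU\<^sub>j\<close> is moved past \<open>\<omega>\<close>.
\<close>

lemma ext_d_fmult:
  assumes \<omega>: "\<omega> \<in> forms_deg m k" and \<eta>: "\<eta> \<in> forms m"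
  shows "ext_d \<Xi> m (fmult \<Xi> \<omega> \<eta>)
    = fmult \<Xi> (ext_d \<Xi> m \<omega>) \<eta> + fscale ((- 1) ^ k) (fmult \<Xi> \<omega> (ext_d \<Xi> m \<eta>))"
proof -
  have f: "\<omega> \<in> forms m"
    using \<omega> by (simp add: forms_deg_def)
  note c = forms_fmult forms_dU forms_fpartial f \<eta>
  have "ext_d \<Xi> m (fmult \<Xi> \<omega> \<eta>) = (\<Sum>j<m. fmult \<Xi> (dU j) (fpartial j (fmult \<Xi> \<omega> \<eta>)))"
    by (intro ext_d_eq c)
  also have "\<dots> = (\<Sum>j<m. fmult \<Xi> (fmult \<Xi> (dU j) (fpartial j \<omega>)) \<eta>
      + fscale ((- 1) ^ k) (fmult \<Xi> \<omega> (fmult \<Xi> (dU j) (fpartial j \<eta>))))"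
  proof (rule sum.cong[OF refl])
    fix j assume "j \<in> {..<m}"
    then have j: "j < m"
      by simp
    have "fmult \<Xi> (dU j) (fmult \<Xi> \<omega> (fpartial j \<eta>))
        = fscale ((- 1) ^ k * (- 1) ^ k) (fmult \<Xi> (fmult \<Xi> (dU j) \<omega>) (fpartial j \<eta>))"
      by (simp add: fmult_assoc[where m = m] c j)
    also have "\<dots> = fscale ((- 1) ^ k) (fmult \<Xi> (fmult \<Xi> \<omega> (dU j)) (fpartial j \<eta>))"
      by (simp add: fmult_dU_commute[OF \<omega> j] fmult_fscale_left fscale_fscale)
    also have "\<dots> = fscale ((- 1) ^ k) (fmult \<Xi> \<omega> (fmult \<Xi> (dU j) (fpartial j \<eta>)))"
      by (simp add: fmult_assoc[where m = m] c j)
    finally show "fmult \<Xi> (dU j) (fpartial j (fmult \<Xi> \<omega> \<eta>))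
        = fmult \<Xi> (fmult \<Xi> (dU j) (fpartial j \<omega>)) \<eta>
          + fscale ((- 1) ^ k) (fmult \<Xi> \<omega> (fmult \<Xi> (dU j) (fpartial j \<eta>)))"
      by (simp add: fpartial_fmult[where m = m] fmult_add_right[where m = m]
          fmult_assoc[where m = m] c j)
  qed
  also have "\<dots> = fmult \<Xi> (ext_d \<Xi> m \<omega>) \<eta> + fscale ((- 1) ^ k) (fmult \<Xi> \<omega> (ext_d \<Xi> m \<eta>))"
  proof -
    have "fmult \<Xi> (ext_d \<Xi> m \<omega>) \<eta> = (\<Sum>j<m. fmult \<Xi> (fmult \<Xi> (dU j) (fpartial j \<omega>)) \<eta>)"
      unfolding ext_d_eq[OF f] by (rule fmult_sum_left[where m = m]) (auto intro!: c)
    moreover have "fmult \<Xi> \<omega> (ext_d \<Xi> m \<eta>) = (\<Sum>j<m. fmult \<Xi> \<omega> (fmult \<Xi> (dU j) (fpartial j \<eta>)))"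
      unfolding ext_d_eq[OF \<eta>] by (rule fmult_sum_right[where m = m]) (auto intro!: c)
    ultimately show ?thesis
      by (simp only: sum.distrib fscale_sum)
  qed
  finally show ?thesis .
qed

text \<open>
  In \<open>\<Sum>\<^sub>i\<^sub>j dU\<^sub>i dU\<^sub>j \<partial>\<^sub>i \<partial>\<^sub>j\<close> the product \<open>dU\<^sub>i dU\<^sub>j\<close> is antisymmetric in \<open>i, j\<close> and \<open>\<partial>\<^sub>i \<partial>\<^sub>j\<close> is symmetric, so
  the sum equals its own negative.
\<close>

lemma ext_d_ext_d:
  assumes \<omega>: "\<omega> \<in> forms m"
  shows "ext_d \<Xi> m (ext_d \<Xi> m \<omega>) = 0"
proof -
  let ?t = "\<lambda>i j. fmult \<Xi> (dU i) (fmult \<Xi> (dU j) (fpartial i (fpartial j \<omega>)))"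
  note c = forms_fmult forms_dU forms_fpartial \<omega>
  have "ext_d \<Xi> m (ext_d \<Xi> m \<omega>) = (\<Sum>i<m. fmult \<Xi> (dU i) (fpartial i (ext_d \<Xi> m \<omega>)))"
    by (intro ext_d_eq forms_ext_d \<omega>)
  also have "\<dots> = (\<Sum>i<m. \<Sum>j<m. ?t i j)"
  proof (rule sum.cong[OF refl])
    fix i assume "i \<in> {..<m}"
    then have "fpartial i (ext_d \<Xi> m \<omega>) = (\<Sum>j<m. fmult \<Xi> (dU j) (fpartial i (fpartial j \<omega>)))"
      by (simp add: ext_d_eq[OF \<omega>] fpartial_sum fpartial_fmult[where m = m] c)
    then show "fmult \<Xi> (dU i) (fpartial i (ext_d \<Xi> m \<omega>)) = (\<Sum>j<m. ?t i j)"
      using \<open>i \<in> {..<m}\<close> by (subst fmult_sum_right[where m = m, symmetric]) (auto intro!: c)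
  qed
  finally have dd: "ext_d \<Xi> m (ext_d \<Xi> m \<omega>) = (\<Sum>i<m. \<Sum>j<m. ?t i j)" .
  have anti: "?t i j = - ?t j i" if "i < m" "j < m" for i j
  proof -
    have "dU i \<in> forms_deg m 1"
      using forms_dU[OF that(1)] by (auto simp: forms_deg_def felem_def)
    from fmult_dU_commute[OF this that(2), of \<Xi>]
    have "fmult \<Xi> (fmult \<Xi> (dU i) (dU j)) (fpartial i (fpartial j \<omega>))
        = fscale (- 1) (fmult \<Xi> (fmult \<Xi> (dU j) (dU i)) (fpartial i (fpartial j \<omega>)))"
      by (simp add: fmult_fscale_left)
    then show ?thesis
      using that by (simp add: fmult_assoc[where m = m] c fscale_minus_one fpartial_commute[of i j])
  qed
  have "(\<Sum>i<m. \<Sum>j<m. ?t i j) = (\<Sum>i<m. \<Sum>j<m. - ?t j i)"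
    by (intro sum.cong refl anti) auto
  also have "\<dots> = - (\<Sum>i<m. \<Sum>j<m. ?t i j)"
    by (subst sum.swap) (simp add: sum_negf)
  finally have "ext_d \<Xi> m (ext_d \<Xi> m \<omega>) = - ext_d \<Xi> m (ext_d \<Xi> m \<omega>)"
    unfolding dd .
  then show ?thesis
    by (simp add: fun_eq_iff)
qed

section \<open>The Hodge operator\<close>

text \<open>Reading off one coefficient shows that the Hodge operator only relabels and rescales coefficients.\<close>

lemma hodge_eq:
  "hodge m \<omega> = (\<lambda>K. if K \<subseteq> {..<m} then qscale (wedge_sign ({..<m} - K) K) (\<omega> ({..<m} - K)) else 0)"
proof
  fix K
  let ?c = "\<lambda>I. qscale (wedge_sign I ({..<m} - I)) (\<omega> I)"
  have "hodge m \<omega> K = (\<Sum>I\<in>Pow {..<m}. if K = {..<m} - I then ?c I else 0)"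
    by (simp add: hodge_def sum_fun_apply felem_def)
  also have "\<dots> = (\<Sum>I\<in>Pow {..<m}. if {..<m} - K = I \<and> K \<subseteq> {..<m} then ?c I else 0)"
    by (intro sum.cong if_cong refl) auto
  also have "\<dots> = (if K \<subseteq> {..<m} then ?c ({..<m} - K) else 0)"
    by (cases "K \<subseteq> {..<m}") (simp_all add: sum.delta)
  finally show "hodge m \<omega> K
      = (if K \<subseteq> {..<m} then qscale (wedge_sign ({..<m} - K) K) (\<omega> ({..<m} - K)) else 0)"
    by (simp add: double_diff)
qed

lemma forms_hodge: "\<omega> \<in> forms m \<Longrightarrow> hodge m \<omega> \<in> forms m"
  by (auto simp: hodge_eq forms_def qtorus_qscale)

lemma forms_deg_hodge:
  assumes "\<omega> \<in> forms_deg m k" "k \<le> m"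
  shows "hodge m \<omega> \<in> forms_deg m (m - k)"
proof -
  have "\<omega> ({..<m} - K) = 0" if "K \<subseteq> {..<m}" "card K \<noteq> m - k" for K
  proof -
    have "card ({..<m} - K) = m - card K" "card K \<le> m"
      using that(1) card_mono[OF finite_lessThan that(1)] by (auto simp: card_Diff_subset finite_subset)
    then have "card ({..<m} - K) \<noteq> k"
      using that(2) by linarith
    then show ?thesis
      using assms(1) by (simp add: forms_deg_def)
  qed
  then show ?thesis
    using forms_hodge[of \<omega> m] assms(1) by (auto simp: forms_deg_def hodge_eq)
qed

lemma hodge_add: "hodge m (\<omega> + \<eta>) = hodge m \<omega> + hodge m \<eta>"
  by (auto simp: hodge_eq qscale_add)

lemma hodge_fmult_form0:
  assumes "\<omega> \<in> forms m"
  shows "hodge m (fmult \<Xi> (form0 b) \<omega>) = fmult \<Xi> (form0 b) (hodge m \<omega>)"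
    and "hodge m (fmult \<Xi> \<omega> (form0 b)) = fmult \<Xi> (hodge m \<omega>) (form0 b)"
  unfolding fmult_form0_left[OF assms] fmult_form0_left[OF forms_hodge[OF assms]]
    fmult_form0_right[OF assms] fmult_form0_right[OF forms_hodge[OF assms]]
  by (auto simp: hodge_eq qmult_qscale_left qmult_qscale_right)

section \<open>The rank-one module and its tensor product with forms\<close>

text \<open>
  This identifies the coinvariants of the coaction: the elements of the total algebra in which the last
  generator does not occur.
\<close>

lemma qtorus_Suc_iff: "a \<in> qtorus n \<longleftrightarrow> a \<in> qtorus (Suc n) \<and> (\<forall>k. k n \<noteq> 0 \<longrightarrow> a k = 0)"
proof safe
  assume a: "a \<in> qtorus n"
  show out: "a k = 0" if "k n \<noteq> 0" for k
    using that qtorus_support[OF a, of k] by (auto simp: exponents_def)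
  show "a \<in> qtorus (Suc n)"
  proof (rule qtorusI)
    fix k :: exponent
    assume "k \<notin> exponents (Suc n)"
    then have "k \<notin> exponents n"
      using Suc_leD by (fastforce simp: exponents_def)
    then show "a k = 0"
      by (rule qtorus_support[OF a])
  next
    fix N
    obtain C where C: "\<And>k. weight n k ^ N * cmod (a k) \<le> C" "0 \<le> C"
      using qtorus_decay[OF a] by blast
    have "weight (Suc n) k ^ N * cmod (a k) \<le> C" for k
      using C(1)[of k] C(2) out[of k] by (cases "k n = 0") (auto simp: weight_def)
    then show "\<exists>C. \<forall>k\<in>exponents (Suc n). weight (Suc n) k ^ N * cmod (a k) \<le> C"
      by blast
  qed
next
  assume a: "a \<in> qtorus (Suc n)" and out: "\<forall>k. k n \<noteq> 0 \<longrightarrow> a k = 0"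
  show "a \<in> qtorus n"
  proof (rule qtorusI)
    fix k :: exponent
    assume k: "k \<notin> exponents n"
    show "a k = 0"
    proof (cases "k n = 0")
      case True
      obtain i where "n \<le> i" "k i \<noteq> 0"
        using k by (auto simp: exponents_def)
      with True have "Suc n \<le> i"
        by (cases "i = n") auto
      with \<open>k i \<noteq> 0\<close> have "k \<notin> exponents (Suc n)"
        by (auto simp: exponents_def)
      then show ?thesis
        by (rule qtorus_support[OF a])
    qed (use out in blast)
  next
    fix N
    obtain C where C: "\<And>k. weight (Suc n) k ^ N * cmod (a k) \<le> C" "0 \<le> C"
      using qtorus_decay[OF a] by blast
    have "weight n k ^ N * cmod (a k) \<le> C" for k
      using C(1)[of k] C(2) out by (cases "k n = 0") (auto simp: weight_def)
    then show "\<exists>C. \<forall>k\<in>exponents n. weight n k ^ N * cmod (a k) \<le> C"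
      by blast
  qed
qed

text \<open>
  Since \<open>ad(\<vartheta>) = \<vartheta> \<otimes> 1\<close>, intertwining means that \<open>T(\<vartheta>)\<close> is coinvariant, and linearity recovers \<open>T\<close>
  from that one value.
\<close>

lemma Mor_coordinate:
  assumes T: "T \<in> Mor n"
  shows "T theta \<in> qtorus n" and "T = (\<lambda>v. qscale v (T theta))"
proof -
  have add: "T (v + w) = T v + T w" and scale: "T (c * v) = qscale c (T v)"
    and q: "T v \<in> qtorus (Suc n)" and co: "coaction n (T v) = (\<lambda>l. T (ad v l))" for v w c
    using T by (auto simp: Mor_def)
  have "T theta k = 0" if "k n \<noteq> 0" for k
  proof -
    have "coaction n (T theta) 0 = T theta"
      by (simp add: co ad_def)
    then show ?thesis
      using that by (metis coaction_def)
  qed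
  then show "T theta \<in> qtorus n"
    using q by (intro iffD2[OF qtorus_Suc_iff]) blast
  show "T = (\<lambda>v. qscale v (T theta))"
  proof
    fix v
    show "T v = qscale v (T theta)"
      using scale[of v theta] by (simp add: theta_def)
  qed
qed

lemma scaled_in_Mor:
  assumes b: "b \<in> qtorus n"
  shows "(\<lambda>v. qscale v b) \<in> Mor n"
proof -
  have out: "b k = 0" if "k n \<noteq> 0" for k
    using b that qtorus_Suc_iff[of b n] by blast
  show ?thesis
    unfolding Mor_def mem_Collect_eq
  proof (intro conjI allI)
    show "coaction n (qscale v b) = (\<lambda>l. qscale (ad v l) b)" for v
    proof (intro ext)
      fix l k
      show "coaction n (qscale v b) l k = qscale (ad v l) b k"
        using out[of k] by (cases "l = 0") (auto simp: coaction_def ad_def qscale_def)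
    qed
    show "qscale v b \<in> qtorus (n + 1)" for v
      using b qtorus_Suc_iff[of b n] by (simp add: qtorus_qscale)
  qed (simp_all add: qscale_def fun_eq_iff distrib_right)
qed

lemma Ttriv_in_Mor [simp]: "Ttriv \<in> Mor n"
  unfolding Ttriv_def by (rule scaled_in_Mor) simp

lemma Ttriv_theta [simp]: "Ttriv theta = qone"
  by (simp add: Ttriv_def theta_def)

lemma mor_mult_in_Mor:
  assumes T: "T \<in> Mor n" and b: "b \<in> qtorus n"
  shows "mor_mult \<Xi> T b \<in> Mor n"
proof -
  have "mor_mult \<Xi> T b = (\<lambda>v. qscale v (qmult \<Xi> (T theta) b))"
    by (subst Mor_coordinate(2)[OF T]) (simp add: mor_mult_def qmult_qscale_left)
  then show ?thesis
    using scaled_in_Mor[OF qtorus_qmult[OF Mor_coordinate(1)[OF T] b]] by simp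
qed

lemma Mor_eq_Ttriv_mult:
  assumes T: "T \<in> Mor n"
  shows "T = mor_mult \<Xi> Ttriv (T theta)"
  by (subst Mor_coordinate(2)[OF T]) (simp add: mor_mult_def Ttriv_def qmult_qscale_left)

lemma Mor_add:
  assumes "S \<in> Mor n" "T \<in> Mor n"
  shows "S + T \<in> Mor n"
proof -
  have "S + T = (\<lambda>v. qscale v (S theta + T theta))"
    by (subst Mor_coordinate(2)[OF assms(1)], subst Mor_coordinate(2)[OF assms(2)])
      (simp add: fun_eq_iff qscale_add)
  then show ?thesis
    using scaled_in_Mor[OF qtorus_add[OF assms[THEN Mor_coordinate(1)]]] by simp
qed

lemma form0_in_forms [simp]: "b \<in> qtorus n \<Longrightarrow> form0 b \<in> forms n"
  by (rule forms_felem) auto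

lemma form0_in_forms_deg: "b \<in> qtorus n \<Longrightarrow> form0 b \<in> forms_deg n 0"
  using form0_in_forms[of b n] by (auto simp: forms_deg_def felem_def)

lemma form0_add: "form0 (a + b) = form0 a + form0 b"
  by (auto simp: felem_def)

lemma form0_qmult: "form0 (qmult \<Xi> a b) = fmult \<Xi> (form0 a) (form0 b)"
  by (simp add: fmult_felem)

lemma abelian_group_form_group: "comm_group (form_group n)"
proof (rule comm_groupI)
  fix \<omega> assume "\<omega> \<in> carrier (form_group n)"
  then show "\<exists>\<eta>\<in>carrier (form_group n). \<eta> \<otimes>\<^bsub>form_group n\<^esub> \<omega> = \<one>\<^bsub>form_group n\<^esub>"
    using forms_fscale[of \<omega> n "- 1"]
    by (auto simp: form_group_def fscale_minus_one intro!: bexI[of _ "- \<omega>"])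
qed (auto simp: form_group_def forms_add ac_simps)

context
  fixes \<Xi> :: "nat \<Rightarrow> nat \<Rightarrow> real" and n :: nat
begin

abbreviation (input) E where "E \<equiv> tensor \<Xi> n"
abbreviation (input) G where "G \<equiv> tensor_free n"
abbreviation (input) N where "N \<equiv> generate (tensor_free n) (tensor_rels \<Xi> n)"
abbreviation (input) triv :: "qform \<Rightarrow> tens" where "triv \<equiv> tns \<Xi> n Ttriv"

lemma comm_group_tensor_free: "comm_group G"
  by (simp add: tensor_free_def abelian_free_Abelian_group)

lemma carrier_tensor_free: "x \<in> carrier G \<longleftrightarrow> Poly_Mapping.keys x \<subseteq> Mor n \<times> forms n"
  by (simp add: tensor_free_def)

lemma frag_of_in_tensor_free: "T \<in> Mor n \<Longrightarrow> \<omega> \<in> forms n \<Longrightarrow> frag_of (T, \<omega>) \<in> carrier G"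
  by (simp add: tensor_free_def)

lemma tensor_free_diff: "x \<in> carrier G \<Longrightarrow> y \<in> carrier G \<Longrightarrow> x - y \<in> carrier G"
  using keys_diff[of x y] by (auto simp: carrier_tensor_free)

lemma tensor_free_ops: "x \<otimes>\<^bsub>G\<^esub> y = x + y" "\<one>\<^bsub>G\<^esub> = 0"
  "x \<in> carrier G \<Longrightarrow> inv\<^bsub>G\<^esub> x = - x"
  by (simp_all add: tensor_free_def)

lemma tensor_rels_in_carrier: "tensor_rels \<Xi> n \<subseteq> carrier G"
  unfolding tensor_rels_def
  by (auto intro!: tensor_free_diff frag_of_in_tensor_free Mor_add forms_add mor_mult_in_Mor
      forms_fmult)

lemma normal_tensor_rels: "N \<lhd> G"
  by (intro comm_group.subgroup_imp_normal comm_group_tensor_free group.generate_is_subgroup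
      comm_group.axioms(2) tensor_rels_in_carrier)

lemma comm_group_tensor: "comm_group E"
  unfolding tensor_def
  by (intro comm_group.abelian_FactGroup comm_group_tensor_free normal_imp_subgroup
      normal_tensor_rels)

lemma tensor_coset_eq:
  assumes x: "x \<in> carrier G" and y: "y \<in> carrier G" and rel: "x - y \<in> N"
  shows "N #>\<^bsub>G\<^esub> x = N #>\<^bsub>G\<^esub> y"
proof -
  interpret comm_group G
    by (rule comm_group_tensor_free)
  have N: "subgroup N G"
    by (rule normal_imp_subgroup[OF normal_tensor_rels])
  have "x \<in> N #>\<^bsub>G\<^esub> y"
    using subgroup.rcos_module[OF N is_group y x] rel by (simp add: tensor_free_ops y)
  then show ?thesis
    using repr_independence[OF _ y N] by simp
qed

lemma tensor_coset_add:
  assumes "x \<in> carrier G" "y \<in> carrier G"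
  shows "(N #>\<^bsub>G\<^esub> x) \<otimes>\<^bsub>E\<^esub> (N #>\<^bsub>G\<^esub> y) = N #>\<^bsub>G\<^esub> (x + y)"
  using normal.rcos_sum[OF normal_tensor_rels assms] by (simp add: tensor_def FactGroup_def tensor_free_ops)

lemma tns_add:
  assumes "T \<in> Mor n" "\<omega> \<in> forms n" "\<eta> \<in> forms n"
  shows "tns \<Xi> n T (\<omega> + \<eta>) = tns \<Xi> n T \<omega> \<otimes>\<^bsub>E\<^esub> tns \<Xi> n T \<eta>"
proof -
  note c = frag_of_in_tensor_free[OF assms(1)]
  have s: "frag_of (T, \<omega>) + frag_of (T, \<eta>) \<in> carrier G"
    using monoid.m_closed[OF group.is_monoid[OF comm_group.axioms(2)[OF comm_group_tensor_free]]
        c[OF assms(2)] c[OF assms(3)]] by (simp add: tensor_free_ops)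
  have "frag_of (T, \<omega> + \<eta>) - frag_of (T, \<omega>) - frag_of (T, \<eta>) \<in> tensor_rels \<Xi> n"
    unfolding tensor_rels_def using assms by blast
  then have "frag_of (T, \<omega> + \<eta>) - (frag_of (T, \<omega>) + frag_of (T, \<eta>)) \<in> N"
    by (simp add: generate.incl diff_diff_eq)
  from tensor_coset_eq[OF c[OF forms_add[OF assms(2,3)]] s this] show ?thesis
    by (simp add: tns_def tensor_coset_add c assms)
qed

text \<open>Balancing \<open>T = T\<^sup>t\<^sup>r\<^sup>i\<^sup>v b\<close> over \<open>B\<close> moves the coordinate \<open>b = T(\<vartheta>)\<close> into the form.\<close>

lemma tns_eq_triv:
  assumes T: "T \<in> Mor n" and \<omega>: "\<omega> \<in> forms n"
  shows "tns \<Xi> n T \<omega> = triv (fmult \<Xi> (form0 (T theta)) \<omega>)"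
proof -
  have b: "T theta \<in> qtorus n"
    by (rule Mor_coordinate(1)[OF T])
  have "frag_of (mor_mult \<Xi> Ttriv (T theta), \<omega>) - frag_of (Ttriv, fmult \<Xi> (form0 (T theta)) \<omega>)
      \<in> tensor_rels \<Xi> n"
    unfolding tensor_rels_def using Ttriv_in_Mor b \<omega> by blast
  then have "frag_of (T, \<omega>) - frag_of (Ttriv, fmult \<Xi> (form0 (T theta)) \<omega>) \<in> N"
    by (simp add: generate.incl flip: Mor_eq_Ttriv_mult[OF T])
  then show ?thesis
    unfolding tns_def using T \<omega> b
    by (intro tensor_coset_eq frag_of_in_tensor_free forms_fmult) simp_all
qed

lemma tns_in_tensor: "T \<in> Mor n \<Longrightarrow> \<omega> \<in> forms n \<Longrightarrow> tns \<Xi> n T \<omega> \<in> carrier E"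
  unfolding tns_def tensor_def FactGroup_def RCOSETS_def
  using frag_of_in_tensor_free by auto

lemma triv_hom: "triv \<in> hom (form_group n) E"
  by (rule homI) (simp_all add: form_group_def tns_in_tensor tns_add)

lemma triv_zero: "triv 0 = \<one>\<^bsub>E\<^esub>"
  using hom_one[OF triv_hom comm_group.axioms(2)[OF abelian_group_form_group]
      comm_group.axioms(2)[OF comm_group_tensor]]
  by (simp add: form_group_def)

lemma inv_triv:
  assumes "\<omega> \<in> forms n"
  shows "inv\<^bsub>E\<^esub> (triv \<omega>) = triv (- \<omega>)"
proof -
  interpret comm_group E
    by (rule comm_group_tensor)
  have m: "- \<omega> \<in> forms n"
    using forms_fscale[OF assms, of "- 1"] by (simp add: fscale_minus_one)
  then have "triv (- \<omega>) \<otimes>\<^bsub>E\<^esub> triv \<omega> = \<one>\<^bsub>E\<^esub>"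
    using assms by (simp add: triv_zero flip: tns_add)
  then show ?thesis
    using assms m by (intro inv_equality tns_in_tensor) simp_all
qed

text \<open>
  The tensors \<open>T\<^sup>t\<^sup>r\<^sup>i\<^sup>v \<otimes> \<omega>\<close> contain all generators and are closed under differences.
\<close>

lemma tensor_carrier_triv:
  assumes X: "X \<in> carrier E"
  obtains \<omega> where "\<omega> \<in> forms n" "X = triv \<omega>"
proof -
  interpret comm_group E
    by (rule comm_group_tensor)
  obtain x where x: "x \<in> carrier G" "X = N #>\<^bsub>G\<^esub> x"
    using X by (auto simp: tensor_def FactGroup_def RCOSETS_def)
  have "Poly_Mapping.keys x \<subseteq> Mor n \<times> forms n"
    using x(1) by (simp add: carrier_tensor_free)
  then have "x \<in> carrier G \<and> N #>\<^bsub>G\<^esub> x \<in> triv ` forms n"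
  proof (induction x rule: frag_induction)
    case zero
    have "N #>\<^bsub>G\<^esub> 0 = triv 0"
      using triv_zero comm_group_tensor_free normal_tensor_rels
        group.coset_mult_one[OF comm_group.axioms(2)[OF comm_group_tensor_free]
          subgroup.subset[OF normal_imp_subgroup[OF normal_tensor_rels]]]
      by (simp add: tensor_def FactGroup_def tensor_free_ops)
    then show ?case
      by (auto simp: carrier_tensor_free)
  next
    case (one p)
    then obtain T \<omega> where p: "p = (T, \<omega>)" "T \<in> Mor n" "\<omega> \<in> forms n"
      by auto
    then have "N #>\<^bsub>G\<^esub> frag_of p = triv (fmult \<Xi> (form0 (T theta)) \<omega>)"
      using tns_eq_triv[OF p(2,3)] by (simp add: tns_def)
    then show ?case
      using p frag_of_in_tensor_free[OF p(2,3)] Mor_coordinate(1)[OF p(2)]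
      by (auto intro!: imageI forms_fmult)
  next
    case (diff x y)
    then obtain \<omega> \<eta> where *: "x \<in> carrier G" "y \<in> carrier G" "\<omega> \<in> forms n" "\<eta> \<in> forms n"
      "N #>\<^bsub>G\<^esub> x = triv \<omega>" "N #>\<^bsub>G\<^esub> y = triv \<eta>"
      by auto
    have d: "x - y \<in> carrier G"
      by (rule tensor_free_diff) fact+
    have m: "\<omega> - \<eta> \<in> forms n"
      using forms_add[OF *(3) forms_fscale[OF *(4), of "- 1"]] by (simp add: fscale_minus_one)
    have "N #>\<^bsub>G\<^esub> (x - y) \<in> carrier E"
      using d by (auto simp: tensor_def FactGroup_def RCOSETS_def)
    moreover have "(N #>\<^bsub>G\<^esub> (x - y)) \<otimes>\<^bsub>E\<^esub> triv \<eta> = triv (\<omega> - \<eta>) \<otimes>\<^bsub>E\<^esub> triv \<eta>"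
      using tensor_coset_add[OF d *(2)] tns_add[OF Ttriv_in_Mor m *(4)] *(5,6) by simp
    ultimately have "N #>\<^bsub>G\<^esub> (x - y) = triv (\<omega> - \<eta>)"
      using m *(4) by (simp add: tns_in_tensor)
    then show ?case
      using d m by blast
  qed
  then show thesis
    using that x(2) by blast
qed

text \<open>
  The only use of the universal property of the tensor product: \<open>T \<otimes> \<omega> \<mapsto> T(\<vartheta>)\<omega>\<close> is well defined.  Balance is
  the associativity \<open>(T(\<vartheta>) b)\<omega> = T(\<vartheta>)(b\<omega>)\<close>.  It inverts \<open>\<omega> \<mapsto> T\<^sup>t\<^sup>r\<^sup>i\<^sup>v \<otimes> \<omega>\<close>.
\<close>

lemma tensor_coordinate_hom:
  obtains \<Phi> where "\<Phi> \<in> hom E (form_group n)"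
    "\<And>T \<omega>. T \<in> Mor n \<Longrightarrow> \<omega> \<in> forms n \<Longrightarrow> \<Phi> (tns \<Xi> n T \<omega>) = fmult \<Xi> (form0 (T theta)) \<omega>"
proof -
  let ?f = "\<lambda>(T :: mor, \<omega>). fmult \<Xi> (form0 (T theta)) \<omega>"
  interpret F: comm_group "form_group n"
    by (rule abelian_group_form_group)
  have "?f ` (Mor n \<times> forms n) \<subseteq> carrier (form_group n)"
    by (auto simp: form_group_def intro!: forms_fmult dest: Mor_coordinate(1))
  then obtain h where h: "h \<in> hom G (form_group n)"
    and h_gen: "\<And>p. p \<in> Mor n \<times> forms n \<Longrightarrow> h (frag_of p) = ?f p"
    unfolding tensor_free_def by (rule F.free_Abelian_group_universal) auto
  have h_of: "h (frag_of (T, \<omega>)) = fmult \<Xi> (form0 (T theta)) \<omega>" if "T \<in> Mor n" "\<omega> \<in> forms n" for T \<omega>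
    using h_gen[of "(T, \<omega>)"] that by simp
  have h_diff: "h (x - y) = h x - h y" if "x \<in> carrier G" "y \<in> carrier G" for x y
    using hom_mult[OF h tensor_free_diff[OF that] that(2)]
    by (simp add: tensor_free_ops form_group_def)
  interpret group_hom G "form_group n" h
    by (simp add: group_hom_def group_hom_axioms_def h F.is_group
        comm_group.axioms(2)[OF comm_group_tensor_free])
  note c = frag_of_in_tensor_free tensor_free_diff Mor_coordinate(1) Mor_add mor_mult_in_Mor
    forms_add forms_fmult form0_in_forms
  have "tensor_rels \<Xi> n \<subseteq> kernel G (form_group n) h"
  proof
    fix r assume r: "r \<in> tensor_rels \<Xi> n"
    consider S T \<omega> where "r = frag_of (S + T, \<omega>) - frag_of (S, \<omega>) - frag_of (T, \<omega>)"
        "S \<in> Mor n" "T \<in> Mor n" "\<omega> \<in> forms n"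
      | T \<omega> \<eta> where "r = frag_of (T, \<omega> + \<eta>) - frag_of (T, \<omega>) - frag_of (T, \<eta>)"
        "T \<in> Mor n" "\<omega> \<in> forms n" "\<eta> \<in> forms n"
      | T b \<omega> where "r = frag_of (mor_mult \<Xi> T b, \<omega>) - frag_of (T, fmult \<Xi> (form0 b) \<omega>)"
        "T \<in> Mor n" "b \<in> qtorus n" "\<omega> \<in> forms n"
      using r unfolding tensor_rels_def by blast
    then have "h r = 0"
    proof cases
      case 1
      then show ?thesis
        by (simp add: h_diff h_of c form0_add fmult_add_left[where m = n])
    next
      case 2
      then show ?thesis
        by (simp add: h_diff h_of c fmult_add_right[where m = n])
    next
      case 3
      have "mor_mult \<Xi> T b theta = qmult \<Xi> (T theta) b"
        by (simp add: mor_mult_def)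
      with 3 show ?thesis
        by (simp add: h_diff h_of c form0_qmult fmult_assoc[where m = n])
    qed
    then show "r \<in> kernel G (form_group n) h"
      using r tensor_rels_in_carrier by (auto simp: kernel_def form_group_def)
  qed
  then have "N \<subseteq> kernel G (form_group n) h"
    by (rule G.generate_subgroup_incl[OF _ subgroup_kernel])
  from FactGroup_universal_kernel[OF normal_tensor_rels this]
  obtain g where g: "g \<in> hom (G Mod N) (form_group n)"
    "\<And>x. x \<in> carrier G \<Longrightarrow> g (N #>\<^bsub>G\<^esub> x) = h x"
    by blast
  show thesis
  proof
    show "g \<in> hom E (form_group n)"
      using g(1) by (simp add: tensor_def)
    show "g (tns \<Xi> n T \<omega>) = fmult \<Xi> (form0 (T theta)) \<omega>" if "T \<in> Mor n" "\<omega> \<in> forms n" for T \<omega>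
      using that by (simp add: tns_def g(2) frag_of_in_tensor_free h_of)
  qed
qed

lemma triv_inject:
  assumes "\<omega> \<in> forms n" "\<eta> \<in> forms n"
  shows "triv \<omega> = triv \<eta> \<longleftrightarrow> \<omega> = \<eta>"
proof -
  obtain \<Phi> where "\<And>T \<omega>. T \<in> Mor n \<Longrightarrow> \<omega> \<in> forms n \<Longrightarrow>
      \<Phi> (tns \<Xi> n T \<omega>) = fmult \<Xi> (form0 (T theta)) \<omega>"
    using tensor_coordinate_hom by metis
  from this[of Ttriv] have "\<Phi> (triv \<omega>) = \<omega>" if "\<omega> \<in> forms n" for \<omega>
    using that by simp
  then show ?thesis
    using assms by metis
qed

text \<open>
  As every tensor is \<open>T\<^sup>t\<^sup>r\<^sup>i\<^sup>v \<otimes> \<omega>\<close> for a unique \<open>\<omega>\<close>, the lifted map has to be \<open>T\<^sup>t\<^sup>r\<^sup>i\<^sup>v \<otimes> \<omega> \<mapsto> \<phi> T\<^sup>t\<^sup>r\<^sup>i\<^sup>v \<omega>\<close>;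
  balance against \<open>T\<^sup>t\<^sup>r\<^sup>i\<^sup>v\<close> is all that makes it agree with \<open>\<phi>\<close> on the other elementary tensors.
\<close>

lemma tensor_lift_tns:
  assumes closed: "\<And>\<omega>. \<omega> \<in> forms n \<Longrightarrow> \<phi> Ttriv \<omega> \<in> carrier H"
    and additive: "\<And>\<omega> \<eta>. \<omega> \<in> forms n \<Longrightarrow> \<eta> \<in> forms n \<Longrightarrow>
      \<phi> Ttriv (\<omega> + \<eta>) = \<phi> Ttriv \<omega> \<otimes>\<^bsub>H\<^esub> \<phi> Ttriv \<eta>"
    and balanced: "\<And>T \<omega>. T \<in> Mor n \<Longrightarrow> \<omega> \<in> forms n \<Longrightarrow>
      \<phi> T \<omega> = \<phi> Ttriv (fmult \<Xi> (form0 (T theta)) \<omega>)"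
    and T: "T \<in> Mor n" and \<omega>: "\<omega> \<in> forms n"
  shows "tensor_lift \<Xi> n H \<phi> (tns \<Xi> n T \<omega>) = \<phi> T \<omega>"
proof -
  let ?P = "\<lambda>K. K \<in> hom E H \<and> K \<in> extensional (carrier E) \<and>
     (\<forall>T\<in>Mor n. \<forall>\<omega>\<in>forms n. K (tns \<Xi> n T \<omega>) = \<phi> T \<omega>)"
  define K where "K = restrict (\<lambda>X. \<phi> Ttriv (the_inv_into (forms n) triv X)) (carrier E)"
  have inj: "inj_on triv (forms n)"
    by (auto simp: inj_on_def triv_inject)
  have K_triv: "K (triv \<omega>) = \<phi> Ttriv \<omega>" if "\<omega> \<in> forms n" for \<omega>
    using that by (simp add: K_def tns_in_tensor the_inv_into_f_f[OF inj])
  have K: "?P K"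
  proof (intro conjI ballI)
    show "K \<in> hom E H"
    proof (rule homI)
      fix X assume "X \<in> carrier E"
      then obtain \<omega> where "\<omega> \<in> forms n" "X = triv \<omega>"
        by (rule tensor_carrier_triv)
      then show "K X \<in> carrier H"
        by (simp add: K_triv closed)
    next
      fix X Y assume "X \<in> carrier E" "Y \<in> carrier E"
      then obtain \<omega> \<eta> where "\<omega> \<in> forms n" "X = triv \<omega>" "\<eta> \<in> forms n" "Y = triv \<eta>"
        by (metis tensor_carrier_triv)
      then show "K (X \<otimes>\<^bsub>E\<^esub> Y) = K X \<otimes>\<^bsub>H\<^esub> K Y"
        by (simp add: K_triv forms_add additive flip: tns_add)
    qed
    show "K \<in> extensional (carrier E)"
      by (simp add: K_def)
    show "K (tns \<Xi> n T \<omega>) = \<phi> T \<omega>" if "T \<in> Mor n" "\<omega> \<in> forms n" for T \<omega>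
      unfolding tns_eq_triv[OF that] balanced[OF that]
      using that by (intro K_triv forms_fmult form0_in_forms Mor_coordinate(1))
  qed
  have "K' = K" if "?P K'" for K'
  proof (rule extensionalityI)
    show "K' \<in> extensional (carrier E)" "K \<in> extensional (carrier E)"
      using that K by blast+
    fix X assume "X \<in> carrier E"
    then obtain \<omega> where "\<omega> \<in> forms n" "X = triv \<omega>"
      by (rule tensor_carrier_triv)
    then show "K' X = K X"
      using that by (simp add: K_triv)
  qed
  then have "tensor_lift \<Xi> n H \<phi> = K"
    unfolding tensor_lift_def using K by (intro the_equality)
  then show ?thesis
    using K T \<omega> by blast
qed

lemma tmult_triv:
  assumes \<nu>: "\<nu> \<in> forms n" and \<eta>: "\<eta> \<in> forms n"
  shows "tmult \<Xi> n (triv \<nu>) \<eta> = triv (fmult \<Xi> \<nu> \<eta>)"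
  unfolding tmult_def
proof (rule tensor_lift_tns)
  fix T \<omega> assume T: "T \<in> Mor n" and \<omega>: "\<omega> \<in> forms n"
  then show "tns \<Xi> n T (fmult \<Xi> \<omega> \<eta>) = triv (fmult \<Xi> (fmult \<Xi> (form0 (T theta)) \<omega>) \<eta>)"
    by (simp add: tns_eq_triv[OF T] forms_fmult \<eta> Mor_coordinate(1) fmult_assoc[where m = n])
qed (simp_all add: assms tns_in_tensor forms_fmult fmult_add_left[where m = n] tns_add)

lemma tscale_triv:
  assumes \<nu>: "\<nu> \<in> forms n"
  shows "tscale \<Xi> n c (triv \<nu>) = triv (fscale c \<nu>)"
  unfolding tscale_def
proof (rule tensor_lift_tns)
  fix T \<omega> assume T: "T \<in> Mor n" and \<omega>: "\<omega> \<in> forms n"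
  then show "tns \<Xi> n T (fscale c \<omega>) = triv (fscale c (fmult \<Xi> (form0 (T theta)) \<omega>))"
    by (simp add: tns_eq_triv[OF T] forms_fscale fmult_fscale_right)
qed (simp_all add: assms tns_in_tensor forms_fscale fscale_add tns_add)

lemma thodge_triv:
  assumes \<nu>: "\<nu> \<in> forms n"
  shows "thodge \<Xi> n (triv \<nu>) = triv (hodge n \<nu>)"
  unfolding thodge_def
proof (rule tensor_lift_tns)
  fix T \<omega> assume T: "T \<in> Mor n" and \<omega>: "\<omega> \<in> forms n"
  then show "tns \<Xi> n T (hodge n \<omega>) = triv (hodge n (fmult \<Xi> (form0 (T theta)) \<omega>))"
    by (simp add: tns_eq_triv[OF T] forms_hodge hodge_fmult_form0)
qed (simp_all add: assms tns_in_tensor forms_hodge hodge_add tns_add)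

text \<open>The hypothesis on \<open>L\<close> says that \<open>L\<close> is left multiplication by \<open>\<Psi>\<close> in the trivialisation.\<close>

lemma extend_linear_triv:
  assumes L: "\<And>T. T \<in> Mor n \<Longrightarrow> L T = triv (fmult \<Xi> \<Psi> (form0 (T theta)))"
    and \<Psi>: "\<Psi> \<in> forms n" and \<nu>: "\<nu> \<in> forms n"
  shows "extend_linear \<Xi> n L (triv \<nu>) = triv (fmult \<Xi> \<Psi> \<nu>)"
proof -
  have LT: "tmult \<Xi> n (L T) \<omega> = triv (fmult \<Xi> \<Psi> (fmult \<Xi> (form0 (T theta)) \<omega>))"
    if "T \<in> Mor n" "\<omega> \<in> forms n" for T \<omega>
    using that by (simp add: L tmult_triv forms_fmult \<Psi> Mor_coordinate(1) fmult_assoc[where m = n])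
  have "extend_linear \<Xi> n L (triv \<nu>) = tmult \<Xi> n (L Ttriv) \<nu>"
    unfolding extend_linear_def
    by (rule tensor_lift_tns)
      (simp_all add: LT \<Psi> \<nu> Mor_coordinate(1) forms_fmult forms_add tns_in_tensor tns_add
        fmult_add_right[where m = n] fmult_form0_qone[where m = n])
  then show ?thesis
    by (simp add: LT \<nu> fmult_form0_qone[where m = n])
qed

section \<open>Curvature and the Yang--Mills operator in the trivialisation\<close>

context
  fixes D :: "mor \<Rightarrow> tens" and \<mu> :: qform
  assumes D: "\<And>T. T \<in> Mor n \<Longrightarrow>
      D T = triv (ext_d \<Xi> n (form0 (T theta)) + fmult \<Xi> \<mu> (form0 (T theta)))"
    and \<mu>: "\<mu> \<in> forms_deg n 1"
begin

lemma potential_in_forms: "\<mu> \<in> forms n"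
  using \<mu> by (simp add: forms_deg_def)

text \<open>
  The map \<open>(T, \<nu>) \<mapsto> D(T)\<nu> + T \<otimes> d\<nu>\<close> is balanced because \<open>(db)\<nu> + b d\<nu> = d(b\<nu>)\<close>: it depends on \<open>T\<close> and \<open>\<nu>\<close> only
  through \<open>T(\<vartheta>)\<nu>\<close>.
\<close>

lemma ext_cov_deriv_triv:
  assumes \<nu>: "\<nu> \<in> forms n"
  shows "ext_cov_deriv \<Xi> n D (triv \<nu>) = triv (ext_d \<Xi> n \<nu> + fmult \<Xi> \<mu> \<nu>)"
proof -
  let ?\<phi> = "\<lambda>T \<nu>. tmult \<Xi> n (D T) \<nu> \<otimes>\<^bsub>E\<^esub> tns \<Xi> n T (ext_d \<Xi> n \<nu>)"
  let ?c = "\<lambda>T \<nu>. fmult \<Xi> (form0 (T theta)) \<nu>"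
  note c = forms_fmult forms_add forms_ext_d potential_in_forms Mor_coordinate(1) form0_in_forms
  have \<phi>: "?\<phi> T \<omega> = triv (ext_d \<Xi> n (?c T \<omega>) + fmult \<Xi> \<mu> (?c T \<omega>))"
    if T: "T \<in> Mor n" and \<omega>: "\<omega> \<in> forms n" for T \<omega>
  proof -
    let ?b = "form0 (T theta)"
    have b: "?b \<in> forms n" "?b \<in> forms_deg n 0"
      using T by (simp_all add: Mor_coordinate(1) form0_in_forms_deg)
    have "?\<phi> T \<omega> = triv (fmult \<Xi> (ext_d \<Xi> n ?b + fmult \<Xi> \<mu> ?b) \<omega> + fmult \<Xi> ?b (ext_d \<Xi> n \<omega>))"
      using T \<omega> by (simp add: D tmult_triv tns_eq_triv[OF T] c flip: tns_add)
    also have "fmult \<Xi> (ext_d \<Xi> n ?b + fmult \<Xi> \<mu> ?b) \<omega> + fmult \<Xi> ?b (ext_d \<Xi> n \<omega>)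
        = ext_d \<Xi> n (?c T \<omega>) + fmult \<Xi> \<mu> (?c T \<omega>)"
      using b \<omega> by (simp add: ext_d_fmult[OF b(2) \<omega>] fmult_add_left[where m = n]
          fmult_assoc[where m = n] c add_ac)
    finally show ?thesis .
  qed
  have \<phi>_triv: "?\<phi> Ttriv \<omega> = triv (ext_d \<Xi> n \<omega> + fmult \<Xi> \<mu> \<omega>)" if "\<omega> \<in> forms n" for \<omega>
    using \<phi>[OF Ttriv_in_Mor that] by (simp only: Ttriv_theta fmult_form0_qone[OF that])
  have "ext_cov_deriv \<Xi> n D (triv \<nu>) = ?\<phi> Ttriv \<nu>"
    unfolding ext_cov_deriv_def
  proof (rule tensor_lift_tns)
    fix \<omega> assume \<omega>: "\<omega> \<in> forms n"
    show "?\<phi> Ttriv \<omega> \<in> carrier E"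
      unfolding \<phi>_triv[OF \<omega>] by (intro tns_in_tensor Ttriv_in_Mor c \<omega>)
    fix \<eta> assume \<eta>: "\<eta> \<in> forms n"
    show "?\<phi> Ttriv (\<omega> + \<eta>) = ?\<phi> Ttriv \<omega> \<otimes>\<^bsub>E\<^esub> ?\<phi> Ttriv \<eta>"
      unfolding \<phi>_triv[OF \<omega>] \<phi>_triv[OF \<eta>] \<phi>_triv[OF forms_add[OF \<omega> \<eta>]]
      using \<omega> \<eta> by (simp add: c ext_d_add[where m = n] fmult_add_right[where m = n] add_ac flip: tns_add)
  next
    fix T \<omega> assume T: "T \<in> Mor n" and \<omega>: "\<omega> \<in> forms n"
    then have "?c T \<omega> \<in> forms n"
      by (intro c)
    then show "?\<phi> T \<omega> = ?\<phi> Ttriv (?c T \<omega>)"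
      unfolding \<phi>[OF T \<omega>] by (rule \<phi>_triv[symmetric])
  qed (simp_all add: \<nu>)
  then show ?thesis
    by (simp only: \<phi>_triv[OF \<nu>])
qed

text \<open>
  With \<open>\<nu> = db + \<mu>b\<close>, the form \<open>d\<nu> + \<mu>\<nu>\<close> is \<open>(d\<mu>)b - \<mu> db + \<mu> db + \<mu>\<mu>b\<close>, because \<open>\<mu>\<close> is odd and \<open>d\<^sup>2 = 0\<close>.
\<close>

lemma curvature_eq:
  assumes T: "T \<in> Mor n"
  shows "curvature \<Xi> n D T = triv (fmult \<Xi> (ext_d \<Xi> n \<mu> + fmult \<Xi> \<mu> \<mu>) (form0 (T theta)))"
proof -
  let ?b = "form0 (T theta)"
  have b: "?b \<in> forms n"
    using T by (simp add: Mor_coordinate(1))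
  note c = forms_fmult forms_add forms_ext_d potential_in_forms b
  have "ext_d \<Xi> n (ext_d \<Xi> n ?b + fmult \<Xi> \<mu> ?b) + fmult \<Xi> \<mu> (ext_d \<Xi> n ?b + fmult \<Xi> \<mu> ?b)
      = fmult \<Xi> (ext_d \<Xi> n \<mu> + fmult \<Xi> \<mu> \<mu>) ?b"
    by (simp add: ext_d_add[where m = n] ext_d_ext_d ext_d_fmult[OF \<mu> b] fscale_minus_one
        fmult_add_left[where m = n] fmult_add_right[where m = n] fmult_assoc[where m = n] c)
  then show ?thesis
    using T by (simp add: curvature_def D ext_cov_deriv_triv c)
qed

text \<open>
  The Leibniz rule for \<open>d(\<Psi>b)\<close> contributes \<open>(-1)\<^sup>k \<Psi> db\<close>, which is the part of \<open>(-1)\<^sup>k \<Psi>(db + \<mu>b)\<close> that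
  involves derivatives of \<open>b\<close>; so the two cancel and the commutator is again left multiplication by a form.
\<close>

lemma qlc_commutator_eq:
  assumes T: "T \<in> Mor n" and \<Psi>: "\<Psi> \<in> forms_deg n k"
    and L: "\<And>T. T \<in> Mor n \<Longrightarrow> L T = triv (fmult \<Xi> \<Psi> (form0 (T theta)))"
  shows "qlc_commutator \<Xi> n k D L T = triv (fmult \<Xi>
    (ext_d \<Xi> n \<Psi> + fmult \<Xi> \<mu> \<Psi> + fscale ((- 1) ^ Suc k) (fmult \<Xi> \<Psi> \<mu>)) (form0 (T theta)))"
proof -
  let ?b = "form0 (T theta)"
  have b: "?b \<in> forms n"
    using T by (simp add: Mor_coordinate(1))
  have f: "\<Psi> \<in> forms n"
    using \<Psi> by (simp add: forms_deg_def)
  note c = forms_fmult forms_add forms_ext_d forms_fscale potential_in_forms b f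
  let ?s = "fscale ((- 1) ^ k) (fmult \<Xi> \<Psi> (ext_d \<Xi> n ?b + fmult \<Xi> \<mu> ?b))"
  let ?d = "ext_d \<Xi> n (fmult \<Xi> \<Psi> ?b) + fmult \<Xi> \<mu> (fmult \<Xi> \<Psi> ?b)"
  have s: "- ?s \<in> forms n"
    using forms_fscale[of ?s n "- 1"] by (simp add: c fscale_minus_one)
  have "qlc_commutator \<Xi> n k D L T = triv (?d + - ?s)"
    unfolding qlc_commutator_def L[OF T] D[OF T]
    using s by (simp add: ext_cov_deriv_triv extend_linear_triv[where L = L and \<Psi> = \<Psi>, OF L f] tscale_triv inv_triv c
        flip: tns_add del: add_uminus_conv_diff)
  also have "?d + - ?s = fmult \<Xi> (ext_d \<Xi> n \<Psi> + fmult \<Xi> \<mu> \<Psi> + fscale ((- 1) ^ Suc k) (fmult \<Xi> \<Psi> \<mu>)) ?b"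
  proof -
    have "- fscale ((- 1) ^ k) \<omega> = fscale ((- 1) ^ Suc k) \<omega>" for \<omega>
      by (simp add: fscale_fscale flip: fscale_minus_one)
    then have neg: "- ?s = fscale ((- 1) ^ Suc k) (fmult \<Xi> \<Psi> (ext_d \<Xi> n ?b + fmult \<Xi> \<mu> ?b))" .
    have cancel: "fscale ((- 1) ^ k) \<omega> + fscale ((- 1) ^ Suc k) \<omega> = 0" for \<omega>
      by (simp flip: fscale_add_left) (simp add: fscale_def zero_fun_def)
    show ?thesis
      unfolding neg using cancel[of "fmult \<Xi> \<Psi> (ext_d \<Xi> n ?b)"]
      by (simp add: ext_d_fmult[OF \<Psi> b] fmult_add_left[where m = n] fmult_add_right[where m = n]
          fmult_assoc[where m = n] fmult_fscale_left fscale_add c algebra_simps del: power_Suc)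
  qed
  finally show ?thesis .
qed

end

end

lemma triv_fmult_form0_eq_one_iff:
  assumes X: "X \<in> forms n"
  shows "(\<forall>T\<in>Mor n. tns \<Xi> n Ttriv (fmult \<Xi> X (form0 (T theta))) = \<one>\<^bsub>tensor \<Xi> n\<^esub>) \<longleftrightarrow> X = 0"
proof
  assume "\<forall>T\<in>Mor n. tns \<Xi> n Ttriv (fmult \<Xi> X (form0 (T theta))) = \<one>\<^bsub>tensor \<Xi> n\<^esub>"
  then have "tns \<Xi> n Ttriv (fmult \<Xi> X (form0 (Ttriv theta))) = tns \<Xi> n Ttriv 0"
    using Ttriv_in_Mor triv_zero by metis
  then show "X = 0"
    using X by (simp add: triv_inject)
qed (simp add: triv_zero)

theorem theorem6p5:
  fixes \<Xi> :: "nat \<Rightarrow> nat \<Rightarrow> real" and n :: nat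
    and D L :: "mor \<Rightarrow> tens" and \<mu> F :: qform
  assumes "n \<ge> 2"
    and "antisymmetric (n + 1) \<Xi>"
    and "qlc \<Xi> n D" and "metric_compatible \<Xi> n D"
    and "\<exists>T\<in>Mor n. D T \<noteq> gauge_qlc \<Xi> n T"
    and "right_linear \<Xi> n 1 L"
    and "\<forall>T\<in>Mor n. D T = gauge_qlc \<Xi> n T \<otimes>\<^bsub>tensor \<Xi> n\<^esub> L T"
    and "L Ttriv = tns \<Xi> n Ttriv \<mu>"
    and "\<mu> \<in> forms_deg n 1" and "\<mu> \<noteq> 0" and "fstar \<Xi> \<mu> = \<mu>"
    and "F = ext_d \<Xi> n \<mu> + fmult \<Xi> \<mu> \<mu>"
  shows "yang_mills_qlc \<Xi> n D \<longleftrightarrow>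
    ext_d \<Xi> n (hodge n F) + fmult \<Xi> \<mu> (hodge n F)
      + fscale ((- 1) ^ (n - 1)) (fmult \<Xi> (hodge n F) \<mu>) = 0"
proof -
  have \<mu>: "\<mu> \<in> forms n"
    using \<open>\<mu> \<in> forms_deg n 1\<close> by (simp add: forms_deg_def)
  have D: "D T = tns \<Xi> n Ttriv (ext_d \<Xi> n (form0 (T theta)) + fmult \<Xi> \<mu> (form0 (T theta)))"
    if T: "T \<in> Mor n" for T
  proof -
    have b: "T theta \<in> qtorus n"
      by (rule Mor_coordinate(1)[OF T])
    have "L T = L (mor_mult \<Xi> Ttriv (T theta))"
      by (simp flip: Mor_eq_Ttriv_mult[OF T])
    also have "\<dots> = tmult \<Xi> n (tns \<Xi> n Ttriv \<mu>) (form0 (T theta))"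
      using \<open>right_linear \<Xi> n 1 L\<close> \<open>L Ttriv = _\<close> b by (simp add: right_linear_def)
    also have "\<dots> = tns \<Xi> n Ttriv (fmult \<Xi> \<mu> (form0 (T theta)))"
      using b by (simp add: tmult_triv \<mu>)
    finally show ?thesis
      using assms(7) T b by (simp add: gauge_qlc_def tns_add forms_ext_d forms_fmult \<mu>)
  qed
  have "fmult \<Xi> \<mu> \<mu> \<in> forms_deg n (1 + 1)" "ext_d \<Xi> n \<mu> \<in> forms_deg n (Suc 1)"
    by (intro forms_deg_fmult forms_deg_ext_d assms)+
  then have F_deg: "F \<in> forms_deg n 2"
    using \<open>F = _\<close> by (auto simp: forms_deg_def forms_add numeral_2_eq_2)
  then have F: "F \<in> forms n"
    by (simp add: forms_deg_def)
  have H_deg: "hodge n F \<in> forms_deg n (n - 2)"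
    by (rule forms_deg_hodge[OF F_deg \<open>n \<ge> 2\<close>])
  have H: "thodge \<Xi> n (curvature \<Xi> n D T) = tns \<Xi> n Ttriv (fmult \<Xi> (hodge n F) (form0 (T theta)))"
    if T: "T \<in> Mor n" for T
    using T F by (simp add: curvature_eq[where D = D and \<mu> = \<mu>, OF D assms(9)] \<open>F = _\<close>[symmetric] thodge_triv
        hodge_fmult_form0 forms_fmult Mor_coordinate(1))
  let ?X = "ext_d \<Xi> n (hodge n F) + fmult \<Xi> \<mu> (hodge n F)
      + fscale ((- 1) ^ (n - 1)) (fmult \<Xi> (hodge n F) \<mu>)"
  \<comment> \<open>The sign \<open>- (-1)\<^sup>n\<^sup>-\<^sup>2\<close> of the commutator is the sign \<open>(-1)\<^sup>n\<^sup>-\<^sup>1\<close> of the equation.\<close>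
  have "Suc (n - 2) = n - 1"
    using \<open>n \<ge> 2\<close> by simp
  then have "yang_mills_qlc \<Xi> n D \<longleftrightarrow>
      (\<forall>T\<in>Mor n. tns \<Xi> n Ttriv (fmult \<Xi> ?X (form0 (T theta))) = \<one>\<^bsub>tensor \<Xi> n\<^esub>)"
    using assms(3,4) by (simp add: yang_mills_qlc_def 
        qlc_commutator_eq[where D = D and \<mu> = \<mu> and L = "\<lambda>T. thodge \<Xi> n (curvature \<Xi> n D T)",
          OF D assms(9) _ H_deg H])
  also have "\<dots> \<longleftrightarrow> ?X = 0"
    by (intro triv_fmult_form0_eq_one_iff forms_add forms_ext_d forms_fscale forms_fmult forms_hodge F \<mu>)
  finally show ?thesis .
qed

end
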